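(* Let $u_1,\dots,u_N$ be coherent utility functions with weakly compact determining sets $\mathcal D_1,\dots,\mathcal D_N$, let $A_n\subseteq L^0$ be a $\mathcal D_n$-consistent convex cone (containing $0$) and $W_n\in L^1_s(\mathcal D_n)$, $n=1,\dots,N$, and let $S$ be a $d$-dimensional random vector whose components belong to $\bigcap_nL^1_s(\mathcal D_n)$. Put $$G_n=\mathrm{cl}\{\mathsf E_{\mathsf Q}S:\mathsf Q\in\mathcal D_n\cap\mathcal R(A_n)\},\qquad\widetilde G_n=\mathrm{cl}\{\mathsf E_{\mathsf Q}(S,W_n):\mathsf Q\in\mathcal D_n\cap\mathcal R(A_n)\},$$ $$f_n(x)=\inf\{y:(x,y)\in\widetilde G_n\},\ x\in G_n,\qquad G=\bigcap_{n=1}^NG_n,\qquad f(x)=\sum_{n=1}^Nf_n(x),\ x\in G,$$ let $G_n^\circ$ be the relative interior of $G_n$, and for $P\in G_n$ put $$N_{\widetilde G_n}(P)=\Bigl\{\eta\in\mathbb R^d:\langle(\eta,1),(P,f_n(P))\rangle=\inf_{x\in\widetilde G_n}\langle(\eta,1),x\rangle\Bigr\}.$$ Assume that $\bigcap_nG_n^\circ\ne\emptyset$. Take $P\in\mathop{\rm argmin}_{x\in G}f(x)$. Then there exist $h_n\in N_{\widetilde G_n}(P)$, $n=1,\dots,N$, such that $\sum_nh_n=0$. Assume that, for each $n$, there exists $X_n\in\mathop{\rm argmax}_{\xi\in A_n}u_n(W_n+\xi+\langle h_n,S\rangle)$. Then $(X_1,\dots,X_N,h_1,\dots,h_N,P)$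 is an Arrow–Debreu-type equilibrium. Conversely, any Arrow–Debreu-type equilibrium $(X_1,\dots,X_N,h_1,\dots,h_N,P)$ has such a form, i.e. $P\in\mathop{\rm argmin}_{x\in G}f(x)$, $h_n\in N_{\widetilde G_n}(P)$ with $\sum_nh_n=0$, and $X_n\in\mathop{\rm argmax}_{\xi\in A_n}u_n(W_n+\xi+\langle h_n,S\rangle)$ for each $n$.
   Context: $(\Omega,\mathcal F,\mathsf P)$ is a probability space, $L^0$ is the space of real random variables, and $\mathcal P$ is the set of probability measures absolutely continuous with respect to $\mathsf P$, identified with their densities in $L^1(\mathsf P)$; weak compactness refers to $\sigma(L^1,L^\infty)$. $\mathsf E_{\mathsf Q}X=\mathsf E_{\mathsf Q}X^+-\mathsf E_{\mathsf Q}X^-$ with $\infty-\infty=-\infty$. A coherent utility function is a map $u:L^0\to[-\infty,\infty]$ of the form $u(X)=\inf_{\mathsf Q\in\mathcal D}\mathsf E_{\mathsf Q}X$ with nonempty $\mathcal D\subset\mathcal P$; its determining set is the largest such $\mathcal D$ (it is convex). $L^1_s(\mathcal D)=\{X\in L^0:\lim_{n\to\infty}\sup_{\mathsf Q\in\mathcal D}\mathsf E_{\mathsf Q}|X|I(|X|>n)=0\}$. $\mathcal R(A)=\{\mathsf Q\in\mathcal P:\mathsf E_{\mathsf Q}X\le0\ \forall X\in A\}$; $A$ is $\mathcal D$-consistent if there is $A'\subseteq A\cap L^1_s(\mathcal D)$ with $\mathcal D\cap\mathcal R(A)=\mathcal D\cap\mathcal R(A')$. "$\mathrm{cl}$" denotes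 closure. $(X_1,\dots,X_N,h_1,\dots,h_N,P)$, with $P\in\mathbb R^d$, is an Arrow–Debreu-type equilibrium if (a) $X_n\in A_n$; (b) $h_n\in\mathbb R^d$, $\sum_nh_n=0$; (c) for every $n$, $$u_n(W_n+X_n+\langle h_n,S-P\rangle)=\max_{\xi\in A_n,\,\eta\in\mathbb R^d}u_n(W_n+\xi+\langle\eta,S-P\rangle).$$ *)

theory Defs
  imports "HOL-Probability.Probability"
begin

definition ac_prob_measures :: "'a measure \<Rightarrow> 'a measure set" where
  "ac_prob_measures M = {Q. prob_space Q \<and> sets Q = sets M \<and> absolutely_continuous M Q}"

text \<open>
  Expectation with values in \<open>[-\<infinity>, \<infinity>]\<close>, with the convention \<open>\<infinity> - \<infinity> = -\<infinity>\<close>. The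
  case distinction is needed because subtraction on \<^typ>\<open>ereal\<close> satisfies \<open>\<infinity> - \<infinity> = \<infinity>\<close>.
\<close>
definition expct :: "'a measure \<Rightarrow> ('a \<Rightarrow> real) \<Rightarrow> ereal" where
  "expct Q X =
    (if (\<integral>\<^sup>+ \<omega>. ennreal (max 0 (- X \<omega>)) \<partial>Q) = \<infinity> then - \<infinity>
     else enn2ereal (\<integral>\<^sup>+ \<omega>. ennreal (max 0 (X \<omega>)) \<partial>Q)
        - enn2ereal (\<integral>\<^sup>+ \<omega>. ennreal (max 0 (- X \<omega>)) \<partial>Q))"

text \<open>
  Random variables are Borel functions rather than equivalence classes modulo null sets; the
  values of a utility function outside \<open>borel_measurable M\<close> play no role.
\<close>
definition represents :: "'a measure \<Rightarrow> 'a measure set \<Rightarrow> (('a \<Rightarrow> real) \<Rightarrow> ereal) \<Rightarrow> bool" where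
  "represents M D u \<longleftrightarrow> D \<noteq> {} \<and> D \<subseteq> ac_prob_measures M \<and>
     (\<forall>X\<in>borel_measurable M. u X = (INF Q\<in>D. expct Q X))"

definition coherent_utility :: "'a measure \<Rightarrow> (('a \<Rightarrow> real) \<Rightarrow> ereal) \<Rightarrow> bool" where
  "coherent_utility M u \<longleftrightarrow> (\<exists>D. represents M D u)"

text \<open>
  For a coherent utility function the greatest representing set exists: it is the union of all
  representing sets.
\<close>
definition determining_set :: "'a measure \<Rightarrow> (('a \<Rightarrow> real) \<Rightarrow> ereal) \<Rightarrow> 'a measure set" where
  "determining_set M u = (GREATEST D. represents M D u)"

text \<open>
  The topology \<open>\<sigma>(L\<^sup>1, L\<^sup>\<infinity>)\<close>, on integrable functions. It does not separate functions that agree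
  almost everywhere, so compactness of a set of functions is compactness of the corresponding
  set of equivalence classes, whichever versions of the densities are chosen.
\<close>
definition weak_L1_topology :: "'a measure \<Rightarrow> ('a \<Rightarrow> real) topology" where
  "weak_L1_topology M = topology_generated_by
     {{Z. integrable M Z \<and> (\<integral>\<omega>. Z \<omega> * g \<omega> \<partial>M) \<in> U} | g U.
        g \<in> borel_measurable M \<and> (\<exists>C. AE \<omega> in M. \<bar>g \<omega>\<bar> \<le> C) \<and> open U}"

definition weakly_compact :: "'a measure \<Rightarrow> 'a measure set \<Rightarrow> bool" where
  "weakly_compact M D \<longleftrightarrow>
     compactin (weak_L1_topology M) ((\<lambda>Q \<omega>. enn2real (RN_deriv M Q \<omega>)) ` D)"

definition L1s :: "'a measure \<Rightarrow> 'a measure set \<Rightarrow> ('a \<Rightarrow> real) set" where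
  "L1s M D = {X \<in> borel_measurable M.
     (\<lambda>n::nat. SUP Q\<in>D. \<integral>\<^sup>+ \<omega>. ennreal (\<bar>X \<omega>\<bar> * indicator {\<omega>. \<bar>X \<omega>\<bar> > real n} \<omega>) \<partial>Q)
       \<longlonglongrightarrow> 0}"

definition risk_neutral :: "'a measure \<Rightarrow> ('a \<Rightarrow> real) set \<Rightarrow> 'a measure set" where
  "risk_neutral M A = {Q \<in> ac_prob_measures M. \<forall>X\<in>A. expct Q X \<le> 0}"

definition consistent :: "'a measure \<Rightarrow> 'a measure set \<Rightarrow> ('a \<Rightarrow> real) set \<Rightarrow> bool" where
  "consistent M D A \<longleftrightarrow>
     (\<exists>A'. A' \<subseteq> A \<inter> L1s M D \<and> D \<inter> risk_neutral M A = D \<inter> risk_neutral M A')"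

text \<open>
  Stated explicitly since the function space carries no \<^class>\<open>real_vector\<close> structure on which
  the library notions \<open>convex\<close> and \<open>cone\<close> could be used.
\<close>
definition convex_cone_rv :: "('a \<Rightarrow> real) set \<Rightarrow> bool" where
  "convex_cone_rv A \<longleftrightarrow> (\<lambda>_. 0) \<in> A \<and>
     (\<forall>X\<in>A. \<forall>c\<ge>0. (\<lambda>\<omega>. c * X \<omega>) \<in> A) \<and>
     (\<forall>X\<in>A. \<forall>Y\<in>A. \<forall>t\<in>{0..1}. (\<lambda>\<omega>. (1 - t) * X \<omega> + t * Y \<omega>) \<in> A)"

text \<open>
  The infima over subsets of \<^typ>\<open>real\<close> in the next two definitions are meaningful for nonempty
  sets bounded below, as for compact \<open>H\<close> and \<open>x\<close> in its projection.
\<close>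
definition lower_boundary :: "('e \<times> real) set \<Rightarrow> 'e \<Rightarrow> real" where
  "lower_boundary H x = Inf {y. (x, y) \<in> H}"

definition normal_directions :: "('e::real_inner \<times> real) set \<Rightarrow> 'e \<Rightarrow> 'e set" where
  "normal_directions H P =
     {\<eta>. (\<eta>, 1) \<bullet> (P, lower_boundary H P) = (INF x\<in>H. (\<eta>, 1) \<bullet> x)}"

text \<open>
  In the last clause the supremum is a maximum, since \<open>(X n, h n)\<close> is itself admissible.
\<close>
definition arrow_debreu_equilibrium ::
  "nat \<Rightarrow> (nat \<Rightarrow> ('a \<Rightarrow> real) \<Rightarrow> ereal) \<Rightarrow> (nat \<Rightarrow> ('a \<Rightarrow> real) set) \<Rightarrow> (nat \<Rightarrow> 'a \<Rightarrow> real) \<Rightarrow>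
   ('a \<Rightarrow> 'e::real_inner) \<Rightarrow> (nat \<Rightarrow> 'a \<Rightarrow> real) \<Rightarrow> (nat \<Rightarrow> 'e) \<Rightarrow> 'e \<Rightarrow> bool" where
  "arrow_debreu_equilibrium N u A W S X h P \<longleftrightarrow>
     (\<forall>n\<in>{1..N}. X n \<in> A n) \<and>
     (\<Sum>n=1..N. h n) = 0 \<and>
     (\<forall>n\<in>{1..N}.
        u n (\<lambda>\<omega>. W n \<omega> + X n \<omega> + h n \<bullet> (S \<omega> - P)) =
        (SUP (\<xi>, \<eta>)\<in>A n \<times> UNIV. u n (\<lambda>\<omega>. W n \<omega> + \<xi> \<omega> + \<eta> \<bullet> (S \<omega> - P))))"

end

theory Submission
  imports Defs
begin

text \<open>
  By a minimax argument (weak compactness yields a finite subcover, and finitely many affine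
  functionals are handled two at a time by separation in the plane), agent \<open>n\<close> who holds \<open>\<eta>\<close> and
  optimises over \<open>A\<^sub>n\<close> has supremal utility \<open>\<phi>\<^sub>n(\<eta>) = inf {\<langle>\<eta>, x\<rangle> + y}\<close> over the
  closed generating set of pairs \<open>(x, y)\<close>. At the price \<open>P\<close> the agent maximises \<open>\<phi>\<^sub>n(\<eta>) - \<langle>\<eta>, P\<rangle>\<close>; by biconjugation the
  supremum is \<open>f\<^sub>n(P)\<close>, and it is attained at \<open>h\<^sub>n\<close> iff \<open>- h\<^sub>n\<close> is a subgradient of \<open>f\<^sub>n\<close> at
  \<open>P\<close>. Market clearing \<open>\<Sum> h\<^sub>n = 0\<close> is thus the Moreau-Rockafellar optimality condition for \<open>\<Sum> f\<^sub>n\<close>.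
\<close>

section \<open>Minimax and the sum rule for subgradients\<close>

text \<open>Members of \<open>A n\<close> need not be integrable, so utilities take values in the
  extended reals, where expectation is not additive. Consistency is what overcomes this: inside
  \<open>D n\<close> the risk-neutral measures are already cut out by those members of
  \<open>A n\<close> whose expectations are finite and weakly continuous. Minimax therefore runs
  over these members alone, and a general \<xi> is only ever added to an integrable endowment.
  Neither the supremum over \<open>A n\<close> nor the infimum over the risk-neutral measures need
  be attained. Duality is therefore proved at levels strictly below the infimum, and the generating
  set is closed up: this leaves infima of linear functionals unchanged and yields a compact convex
  body, whose lower boundary is attained and convex. That an equilibrium price lies in
  \<open>G\<close> is a conclusion: a finite attained optimum bounds the biconjugate at
  \<open>P\<close>. The common relative interior point does its main work in the sum rule, where it
  excludes a vertical supporting hyperplane.\<close>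

text \<open>The hypothesis says that \<open>K\<close> misses the open quadrant below the corner
  \<open>(c, c)\<close>. A line separating the two has a normal with nonnegative entries, because
  the quadrant is unbounded downwards in both coordinates; scaling the entries to sum 1 gives the
  weight \<open>t\<close>.\<close>

lemma two_point_minimax:
  fixes K :: "(real \<times> real) set" and c :: real
  assumes cvx: "convex K" and max: "\<And>x y. (x, y) \<in> K \<Longrightarrow> c \<le> max x y"
  shows "\<exists>t\<in>{0..1}. \<forall>(x, y)\<in>K. c \<le> (1 - t) * x + t * y"
proof (cases "K = {}")
  case False
  let ?B = "{..<c} \<times> {..<c}"
  have "convex ?B" "?B \<noteq> {}" "?B \<inter> K = {}"
    using max by (force intro!: convex_Times lt_ex)+
  from separating_hyperplane_sets[OF this(1) cvx this(2) False this(3)]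
  obtain a b where a0: "a \<noteq> 0" and lo: "\<And>z. z \<in> ?B \<Longrightarrow> a \<bullet> z \<le> b" and hi: "\<And>z. z \<in> K \<Longrightarrow> b \<le> a \<bullet> z"
    by blast
  obtain p q where a: "a = (p, q)" by fastforce
  have lo': "p * x + q * y \<le> b" if "x < c" "y < c" for x y
    using lo[of "(x, y)"] that by (simp add: a inner_Pair)
  have p0: "p \<ge> 0"
  proof (rule ccontr)
    assume "\<not> p \<ge> 0"
    \<comment> \<open>Were \<open>p\<close> negative, lowering the first coordinate by this
      \<open>s\<close> would lift \<open>p * x + q * y\<close> above \<open>b\<close> while staying
      in the quadrant.\<close>
    define s where "s = \<bar>b - q * (c - 1) - p * (c - 1)\<bar> / (- p) + 1"
    have "p < 0" using \<open>\<not> p \<ge> 0\<close> by simp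
    then have "s > 0" unfolding s_def
      by (intro add_nonneg_pos divide_nonneg_pos) auto
    moreover have "- p * s = \<bar>b - q * (c - 1) - p * (c - 1)\<bar> - p"
      using \<open>p < 0\<close> by (simp add: s_def field_simps)
    ultimately show False
      using lo'[of "c - 1 - s" "c - 1"] \<open>p < 0\<close> by (simp add: algebra_simps)
  qed
  have q0: "q \<ge> 0"
  proof (rule ccontr)
    assume "\<not> q \<ge> 0"
    define s where "s = \<bar>b - p * (c - 1) - q * (c - 1)\<bar> / (- q) + 1"
    have "q < 0" using \<open>\<not> q \<ge> 0\<close> by simp
    then have "s > 0" unfolding s_def
      by (intro add_nonneg_pos divide_nonneg_pos) auto
    moreover have "- q * s = \<bar>b - p * (c - 1) - q * (c - 1)\<bar> - q"
      using \<open>q < 0\<close> by (simp add: s_def field_simps)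
    ultimately show False
      using lo'[of "c - 1" "c - 1 - s"] \<open>q < 0\<close> by (simp add: algebra_simps)
  qed
  have pq: "p + q > 0"
    using p0 q0 a0 a by (auto simp: zero_prod_def)
  \<comment> \<open>The corner itself is outside the open quadrant, so it is approached along the
    diagonal.\<close>
  have "(p + q) * c \<le> b"
  proof (rule field_le_epsilon)
    fix e :: real assume "e > 0"
    then have "e / (p + q) > 0" using pq by simp
    then have "p * (c - e / (p + q)) + q * (c - e / (p + q)) \<le> b" by (intro lo') auto
    also have "p * (c - e / (p + q)) + q * (c - e / (p + q)) = (p + q) * (c - e / (p + q))"
      by (rule distrib_right[symmetric])
    also have "\<dots> = (p + q) * c - e"
      using pq by (metis less_irrefl nonzero_mult_div_cancel_left right_diff_distrib times_divide_eq_right)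
    finally show "(p + q) * c \<le> b + e" by simp
  qed
  then have key: "(p + q) * c \<le> p * x + q * y" if "(x, y) \<in> K" for x y
    using hi[OF that] by (simp add: a inner_Pair)
  have "c \<le> (1 - q / (p + q)) * x + q / (p + q) * y" if "(x, y) \<in> K" for x y
  proof -
    have "1 - q / (p + q) = p / (p + q)" using pq by (simp add: field_simps)
    then have "(1 - q / (p + q)) * x + q / (p + q) * y = (p * x + q * y) / (p + q)"
      by (simp only: add_divide_distrib times_divide_eq_left)
    moreover have "c \<le> (p * x + q * y) / (p + q)"
      using key[OF that] pq by (simp only: pos_le_divide_eq mult.commute)
    ultimately show ?thesis by simp
  qed
  moreover have "q / (p + q) \<in> {0..1}" using p0 q0 pq by simp
  ultimately show ?thesis by blast
qed auto

text \<open>Neither random variables nor measures carry a vector space structure here, so convexity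
  is expressed by the existence of elements on which \<Phi> interpolates. The induction discards the
  points where the new function \<open>k\<close> already reaches \<open>c\<close>; a single
  \<open>g\<close> serves the rest by induction, and \<open>g\<close> and \<open>k\<close> are then
  merged by the planar case. This is why \<open>K\<close> varies in the induction.\<close>

lemma finite_minimax:
  fixes \<Phi> :: "'x \<Rightarrow> 'q \<Rightarrow> real"
  assumes "finite F" "F \<noteq> {}" "F \<subseteq> X"
    and cX: "\<And>a b t. a \<in> X \<Longrightarrow> b \<in> X \<Longrightarrow> 0 < t \<Longrightarrow> t < 1 \<Longrightarrow>
      \<exists>\<xi>\<in>X. \<forall>q\<in>K. \<Phi> \<xi> q = (1 - t) * \<Phi> a q + t * \<Phi> b q"
    and cK: "\<And>p q t. p \<in> K \<Longrightarrow> q \<in> K \<Longrightarrow> 0 < t \<Longrightarrow> t < 1 \<Longrightarrow>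
      \<exists>r\<in>K. \<forall>\<xi>\<in>X. \<Phi> \<xi> r = (1 - t) * \<Phi> \<xi> p + t * \<Phi> \<xi> q"
    and "\<And>q. q \<in> K \<Longrightarrow> \<exists>\<xi>\<in>F. c \<le> \<Phi> \<xi> q"
  shows "\<exists>\<xi>\<in>X. \<forall>q\<in>K. c \<le> \<Phi> \<xi> q"
  using assms
proof (induction F arbitrary: K rule: finite_ne_induct)
  case (singleton x)
  then show ?case by (intro bexI[of _ x]) auto
next
  case (insert k F)
  have kX: "k \<in> X" and FX: "F \<subseteq> X" using insert.prems(1) by auto
  \<comment> \<open>A strict sublevel set of a functional that is affine along mixtures, hence
    itself closed under mixtures.\<close>
  define K' where "K' = {q \<in> K. \<Phi> k q < c}"
  have "\<exists>\<xi>\<in>X. \<forall>q\<in>K'. c \<le> \<Phi> \<xi> q"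
  proof (rule insert.IH[OF FX])
    show "\<exists>\<xi>\<in>X. \<forall>q\<in>K'. \<Phi> \<xi> q = (1 - t) * \<Phi> a q + t * \<Phi> b q"
      if "a \<in> X" "b \<in> X" "0 < t" "t < 1" for a b t
      using insert.prems(2)[OF that] by (auto simp: K'_def)
    show "\<exists>r\<in>K'. \<forall>\<xi>\<in>X. \<Phi> \<xi> r = (1 - t) * \<Phi> \<xi> p + t * \<Phi> \<xi> q"
      if "p \<in> K'" "q \<in> K'" and t: "0 < t" "t < 1" for p q t
    proof -
      have pq: "p \<in> K" "q \<in> K" "\<Phi> k p < c" "\<Phi> k q < c" using that by (auto simp: K'_def)
      obtain r where r: "r \<in> K" "\<forall>\<xi>\<in>X. \<Phi> \<xi> r = (1 - t) * \<Phi> \<xi> p + t * \<Phi> \<xi> q"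
        using insert.prems(3)[OF pq(1,2) t] by blast
      have "(1 - t) * \<Phi> k p + t * \<Phi> k q < (1 - t) * c + t * c"
        using pq t by (intro add_strict_mono mult_strict_left_mono) auto
      also have "(1 - t) * c + t * c = c" by (simp add: algebra_simps)
      finally have "\<Phi> k r < c" using r kX by simp
      then show ?thesis using r by (auto simp: K'_def)
    qed
    show "\<exists>\<xi>\<in>F. c \<le> \<Phi> \<xi> q" if "q \<in> K'" for q
      using insert.prems(4)[of q] that by (auto simp: K'_def)
  qed
  then obtain g where g: "g \<in> X" "\<And>q. q \<in> K \<Longrightarrow> \<Phi> k q < c \<Longrightarrow> c \<le> \<Phi> g q"
    by (auto simp: K'_def)
  let ?T = "(\<lambda>q. (\<Phi> g q, \<Phi> k q)) ` K"
  have "convex ?T"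
    unfolding convex_alt
  proof (intro ballI allI impI)
    fix x y and t :: real
    assume xy: "x \<in> ?T" "y \<in> ?T" and t: "0 \<le> t \<and> t \<le> 1"
    then obtain p q where pq: "p \<in> K" "q \<in> K" "x = (\<Phi> g p, \<Phi> k p)" "y = (\<Phi> g q, \<Phi> k q)"
      by auto
    consider "t = 0" | "t = 1" | "0 < t" "t < 1" using t by linarith
    then show "(1 - t) *\<^sub>R x + t *\<^sub>R y \<in> ?T"
    proof cases
      case 3
      then obtain r where "r \<in> K" "\<forall>\<xi>\<in>X. \<Phi> \<xi> r = (1 - t) * \<Phi> \<xi> p + t * \<Phi> \<xi> q"
        using insert.prems(3)[OF pq(1,2)] by blast
      then show ?thesis using pq g kX by (auto intro!: image_eqI[of _ _ r])
    qed (use xy in auto)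
  qed
  moreover have "c \<le> max x y" if "(x, y) \<in> ?T" for x y
    using that g by (fastforce simp: le_max_iff_disj not_less)
  ultimately obtain t where t: "t \<in> {0..1}" "\<forall>(x, y)\<in>?T. c \<le> (1 - t) * x + t * y"
    using two_point_minimax by blast
  then have t': "\<And>q. q \<in> K \<Longrightarrow> c \<le> (1 - t) * \<Phi> g q + t * \<Phi> k q" by auto
  consider "t = 0" | "t = 1" | "0 < t" "t < 1" using t(1) by fastforce
  then show ?case
  proof cases
    case 3
    obtain \<xi> where "\<xi> \<in> X" "\<forall>q\<in>K. \<Phi> \<xi> q = (1 - t) * \<Phi> g q + t * \<Phi> k q"
      using insert.prems(2)[OF g(1) kX 3] by blast
    then show ?thesis using t' by (intro bexI[of _ \<xi>]) auto
  qed (use t' g kX in auto)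
qed

section \<open>The sum rule for subgradients at a constrained minimum\<close>

text \<open>The minimisation is perturbed by letting the two summands use different points
  \<open>x\<close> and \<open>y\<close>. A non-vertical hyperplane supporting the set of pairs
  (difference, excess value) at the origin has slope \<open>h\<close>, the multiplier for the
  constraint \<open>x = y\<close>.\<close>

lemma minimize_sum_two:
  fixes f g :: "'e::euclidean_space \<Rightarrow> real"
  assumes f: "convex_on C f" and g: "convex_on D g"
    and ri: "rel_interior C \<inter> rel_interior D \<noteq> {}"
    and P: "P \<in> C" "P \<in> D" and min: "\<And>x. x \<in> C \<Longrightarrow> x \<in> D \<Longrightarrow> f P + g P \<le> f x + g x"
  shows "\<exists>h. (\<forall>x\<in>C. f P + h \<bullet> P \<le> f x + h \<bullet> x) \<and> (\<forall>x\<in>D. g P - h \<bullet> P \<le> g x - h \<bullet> x)"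
proof -
  have cC: "convex C" and cD: "convex D"
    using f g by (auto intro: convex_on_imp_convex)
  define K where "K = {(x - y, t) | x y t. x \<in> C \<and> y \<in> D \<and> f x - f P + g y - g P \<le> t}"
  have KI: "(x - y, t) \<in> K" if "x \<in> C" "y \<in> D" "f x - f P + g y - g P \<le> t" for x y t
    using that by (auto simp: K_def)
  have "convex K"
    unfolding convex_alt
  proof (intro ballI allI impI)
    fix z z' and s :: real
    assume "z \<in> K" "z' \<in> K" and s: "0 \<le> s \<and> s \<le> 1"
    then obtain x y t x' y' t' where z: "z = (x - y, t)" "x \<in> C" "y \<in> D" "f x - f P + g y - g P \<le> t"
      and z': "z' = (x' - y', t')" "x' \<in> C" "y' \<in> D" "f x' - f P + g y' - g P \<le> t'"
      unfolding K_def by blast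
    have "f ((1 - s) *\<^sub>R x + s *\<^sub>R x') \<le> (1 - s) * f x + s * f x'"
      using convex_onD[OF f] s z z' by simp
    moreover have "g ((1 - s) *\<^sub>R y + s *\<^sub>R y') \<le> (1 - s) * g y + s * g y'"
      using convex_onD[OF g] s z z' by simp
    moreover have "(1 - s) * (f x - f P + g y - g P) + s * (f x' - f P + g y' - g P) \<le> (1 - s) * t + s * t'"
      using s z z' by (intro add_mono mult_left_mono) auto
    ultimately have "f ((1 - s) *\<^sub>R x + s *\<^sub>R x') - f P + g ((1 - s) *\<^sub>R y + s *\<^sub>R y') - g P \<le> (1 - s) * t + s * t'"
      by (simp add: algebra_simps)
    then have "(((1 - s) *\<^sub>R x + s *\<^sub>R x') - ((1 - s) *\<^sub>R y + s *\<^sub>R y'), (1 - s) * t + s * t') \<in> K"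
      using s z z' cC cD by (intro KI) (auto simp: convex_alt)
    then show "(1 - s) *\<^sub>R z + s *\<^sub>R z' \<in> K"
      by (simp add: z z' algebra_simps)
  qed
  have K0: "(0, 0) \<in> K" using KI[of P P 0] P by simp
  have K1: "(0, 1) \<in> K" using KI[of P P 1] P by simp
  \<comment> \<open>A relative interior point lets the segment from \<open>(0, 1)\<close> be
    prolonged beyond it, here to a point over 0 with negative excess; this contradicts the
    minimality of \<open>P\<close>.\<close>
  have "(0, 0) \<notin> rel_interior K"
  proof
    assume "(0, 0) \<in> rel_interior K"
    then obtain e where "e > 1" "(1 - e) *\<^sub>R (0::'e, 1::real) + e *\<^sub>R (0, 0) \<in> K"
      using convex_rel_interior_iff[OF \<open>convex K\<close>] K0 K1 by blast
    then obtain x where "x \<in> C" "x \<in> D" "f x - f P + g x - g P \<le> 1 - e"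
      by (auto simp: K_def)
    then show False using min[of x] \<open>e > 1\<close> by simp
  qed
  then obtain ab where "\<And>z. z \<in> K \<Longrightarrow> ab \<bullet> (0, 0) \<le> ab \<bullet> z"
      and "\<And>z. z \<in> rel_interior K \<Longrightarrow> ab \<bullet> (0, 0) < ab \<bullet> z"
    using supporting_hyperplane_rel_boundary[OF \<open>convex K\<close> K0] by metis
  moreover obtain a b where "ab = (a, b)" by fastforce
  ultimately have le: "\<And>x t. (x, t) \<in> K \<Longrightarrow> 0 \<le> a \<bullet> x + b * t"
      and lt: "\<And>x t. (x, t) \<in> rel_interior K \<Longrightarrow> 0 < a \<bullet> x + b * t"
    by (force simp: inner_Pair)+
  have "b \<ge> 0" using le[OF K1] by simp
  \<comment> \<open>A vertical hyperplane would weakly separate \<open>C\<close> from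
    \<open>D\<close>. A common relative interior point forces \<open>a\<close> to be constant on
    both, with the same value, and then the strict inequality \<open>lt\<close> fails.\<close>
  have "b \<noteq> 0"
  proof
    assume b: "b = 0"
    have ge: "a \<bullet> y \<le> a \<bullet> x" if "x \<in> C" "y \<in> D" for x y
      using le[OF KI[OF that order_refl]] b by (simp add: inner_diff_right)
    obtain z where z: "z \<in> rel_interior C" "z \<in> rel_interior D" using ri by blast
    then have zz: "z \<in> C" "z \<in> D" using rel_interior_subset by auto
    have C: "a \<bullet> x = a \<bullet> z" if x: "x \<in> C" for x
    proof -
      obtain e where "e > 1" "(1 - e) *\<^sub>R x + e *\<^sub>R z \<in> C"
        using convex_rel_interior_iff[OF cC] z x by blast
      then have "a \<bullet> z \<le> (1 - e) * (a \<bullet> x) + e * (a \<bullet> z)"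
        using ge[OF _ zz(2)] by (force simp: inner_add_right)
      then have "(e - 1) * (a \<bullet> x) \<le> (e - 1) * (a \<bullet> z)" by (simp add: algebra_simps)
      then have "a \<bullet> x \<le> a \<bullet> z" using \<open>e > 1\<close> by simp
      then show ?thesis using ge[OF x zz(2)] by simp
    qed
    have D: "a \<bullet> y = a \<bullet> z" if y: "y \<in> D" for y
    proof -
      obtain e where "e > 1" "(1 - e) *\<^sub>R y + e *\<^sub>R z \<in> D"
        using convex_rel_interior_iff[OF cD] z y by blast
      then have "(1 - e) * (a \<bullet> y) + e * (a \<bullet> z) \<le> a \<bullet> z"
        using ge[OF zz(1)] by (force simp: inner_add_right)
      then have "(e - 1) * (a \<bullet> z) \<le> (e - 1) * (a \<bullet> y)" by (simp add: algebra_simps)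
      then have "a \<bullet> z \<le> a \<bullet> y" using \<open>e > 1\<close> by simp
      then show ?thesis using ge[OF zz(1) y] by simp
    qed
    obtain w t where wt: "(w, t) \<in> rel_interior K"
      using rel_interior_eq_empty[OF \<open>convex K\<close>] K0 by fastforce
    then obtain x y where "w = x - y" "x \<in> C" "y \<in> D"
      using rel_interior_subset by (force simp: K_def)
    then show False using lt[OF wt] b C D by (simp add: inner_diff_right)
  qed
  with \<open>b \<ge> 0\<close> have "b > 0" by simp
  define h where "h = a /\<^sub>R b"
  have ah: "a \<bullet> v = b * (h \<bullet> v)" for v using \<open>b > 0\<close> by (simp add: h_def)
  have key: "0 \<le> h \<bullet> (x - y) + (f x - f P + g y - g P)" if "x \<in> C" "y \<in> D" for x y
  proof -
    have "0 \<le> b * (h \<bullet> (x - y) + (f x - f P + g y - g P))"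
      using le[OF KI[OF that order_refl]] by (simp add: ah algebra_simps)
    then show ?thesis using \<open>b > 0\<close> by (simp add: zero_le_mult_iff)
  qed
  show ?thesis
  proof (intro exI conjI ballI)
    show "f P + h \<bullet> P \<le> f x + h \<bullet> x" if "x \<in> C" for x
      using key[OF that P(2)] by (simp add: inner_diff_right)
    show "g P - h \<bullet> P \<le> g x - h \<bullet> x" if "x \<in> D" for x
      using key[OF P(1) that] by (simp add: inner_diff_right)
  qed
qed

text \<open>The linear tilt \<open>c\<close> makes the statement inductive: after splitting off
  index \<open>j\<close> with multiplier \<open>h\<close>, the remaining sum is minimal at
  \<open>P\<close> under the tilt \<open>c + h\<close>, and \<open>j\<close> receives
  \<open>- h\<close>.\<close>

lemma minimize_sum:
  fixes f :: "'i \<Rightarrow> 'e::euclidean_space \<Rightarrow> real"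
  assumes "finite I" and "\<And>i. i \<in> I \<Longrightarrow> convex_on (C i) (f i)"
    and "(\<Inter>i\<in>I. rel_interior (C i)) \<noteq> {}" and "P \<in> (\<Inter>i\<in>I. C i)"
    and "\<And>x. x \<in> (\<Inter>i\<in>I. C i) \<Longrightarrow> (\<Sum>i\<in>I. f i P) + c \<bullet> P \<le> (\<Sum>i\<in>I. f i x) + c \<bullet> x"
  shows "\<exists>h. (\<Sum>i\<in>I. h i) = c \<and> (\<forall>i\<in>I. \<forall>x\<in>C i. f i P + h i \<bullet> P \<le> f i x + h i \<bullet> x)"
  using assms
proof (induction I arbitrary: c rule: finite_induct)
  case empty
  \<comment> \<open>With no summands the constraint set is the whole space, and the test point
    \<open>P - c\<close> shows that only a zero tilt can be minimised.\<close>
  have "c \<bullet> P \<le> c \<bullet> (P - c)" using empty(4)[of "P - c"] by simp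
  then have "c \<bullet> c \<le> 0" by (simp add: inner_diff_right)
  then have "c = 0" by (metis inner_eq_zero_iff inner_ge_zero order_antisym)
  then show ?case by simp
next
  case (insert j I)
  let ?C = "\<Inter>i\<in>I. C i"
  let ?F = "\<lambda>x. (\<Sum>i\<in>I. f i x) + c \<bullet> x"
  have cvC: "convex (C i)" if "i \<in> insert j I" for i
    using insert.prems(1)[OF that] by (rule convex_on_imp_convex)
  then have cC: "convex ?C" by (auto intro: convex_INT)
  have cF: "convex_on ?C (\<lambda>x. (\<Sum>i\<in>I. f i x) + c \<bullet> x)"
  proof (rule convex_onI[OF _ cC])
    fix t x y assume t: "0 < t" "t < (1::real)" and xy: "x \<in> ?C" "y \<in> ?C"
    have "(\<Sum>i\<in>I. f i ((1 - t) *\<^sub>R x + t *\<^sub>R y)) \<le> (\<Sum>i\<in>I. (1 - t) * f i x + t * f i y)"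
      using t xy insert.prems(1) by (intro sum_mono convex_onD[of "C _"]) auto
    also have "\<dots> = (1 - t) * (\<Sum>i\<in>I. f i x) + t * (\<Sum>i\<in>I. f i y)"
      by (simp only: sum.distrib sum_distrib_left)
    finally show "?F ((1 - t) *\<^sub>R x + t *\<^sub>R y) \<le> (1 - t) * ?F x + t * ?F y"
      by (simp add: inner_add_right distrib_left)
  qed
  \<comment> \<open>Relative interior commutes with a finite intersection once the relative
    interiors meet; this carries the qualification condition through the induction.\<close>
  have ri: "rel_interior ?C = (\<Inter>i\<in>I. rel_interior (C i))"
  proof -
    have "rel_interior (\<Inter>(C ` I)) = \<Inter>(rel_interior ` (C ` I))"
      by (rule convex_rel_interior_finite_Inter) (use insert.prems(2) insert.hyps cvC in auto)
    then show ?thesis by (simp add: image_image)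
  qed
  have "\<exists>h. (\<forall>x\<in>?C. ?F P + h \<bullet> P \<le> ?F x + h \<bullet> x) \<and> (\<forall>x\<in>C j. f j P - h \<bullet> P \<le> f j x - h \<bullet> x)"
  proof (rule minimize_sum_two[OF cF])
    show "convex_on (C j) (f j)" using insert.prems(1) by simp
    show "rel_interior ?C \<inter> rel_interior (C j) \<noteq> {}"
      unfolding ri using insert.prems(2) by auto
    show "P \<in> ?C" "P \<in> C j" using insert.prems(3) by auto
    show "?F P + f j P \<le> ?F x + f j x" if "x \<in> ?C" "x \<in> C j" for x
      using insert.prems(4)[of x] insert.hyps that by (simp add: algebra_simps)
  qed
  then obtain h where h: "\<And>x. x \<in> ?C \<Longrightarrow> ?F P + h \<bullet> P \<le> ?F x + h \<bullet> x"
      "\<And>x. x \<in> C j \<Longrightarrow> f j P - h \<bullet> P \<le> f j x - h \<bullet> x" by blast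
  have "\<exists>k. (\<Sum>i\<in>I. k i) = c + h \<and> (\<forall>i\<in>I. \<forall>x\<in>C i. f i P + k i \<bullet> P \<le> f i x + k i \<bullet> x)"
  proof (rule insert.IH)
    show "(\<Sum>i\<in>I. f i P) + (c + h) \<bullet> P \<le> (\<Sum>i\<in>I. f i x) + (c + h) \<bullet> x" if "x \<in> ?C" for x
      using h(1)[OF that] by (simp add: inner_add_left)
  qed (use insert.prems in auto)
  then obtain k where k: "(\<Sum>i\<in>I. k i) = c + h" "\<forall>i\<in>I. \<forall>x\<in>C i. f i P + k i \<bullet> P \<le> f i x + k i \<bullet> x"
    by blast
  have eq: "(\<Sum>i\<in>I. (k(j := - h)) i) = (\<Sum>i\<in>I. k i)"
    using insert.hyps by (intro sum.cong) auto
  show ?case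
    using k h(2) insert.hyps eq by (intro exI[of _ "k(j := - h)"]) auto
qed

section \<open>Lower boundaries of convex bodies\<close>

text \<open>Boundedness makes the closure compact, so its projection is closed; projections of
  unbounded closed sets can fail to be.\<close>

lemma fst_closure_bounded:
  fixes H :: "('e::euclidean_space \<times> real) set"
  assumes "bounded H"
  shows "fst ` closure H = closure (fst ` H)"
proof
  have "compact (closure H)" using assms by simp
  then have "closed (fst ` closure H)"
    by (intro compact_imp_closed compact_continuous_image continuous_intros)
  then show "closure (fst ` H) \<subseteq> fst ` closure H"
    by (intro closure_minimal image_mono closure_subset)
  show "fst ` closure H \<subseteq> closure (fst ` H)"
    by (intro image_closure_subset continuous_intros closure_subset closed_closure)
qed

locale convex_body =
  fixes K :: "('e::euclidean_space \<times> real) set"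
  assumes cpt: "compact K" and cvx: "convex K" and nonempty: "K \<noteq> {}"
begin

text \<open>In terms of convex conjugates this is \<open>- f*(- \<eta>)\<close>, where
  \<open>f\<close> is the lower boundary: the last coordinate 1 of the direction selects the bottom
  of each fibre.\<close>

definition support :: "'e \<Rightarrow> real" where
  "support \<eta> = (INF z\<in>K. (\<eta>, 1) \<bullet> z)"

lemma bdd: "bdd_below ((\<lambda>z. (\<eta>, 1) \<bullet> z) ` K)"
  by (intro bounded_imp_bdd_below compact_imp_bounded compact_continuous_image cpt continuous_intros)

lemma support_le: "(x, y) \<in> K \<Longrightarrow> support \<eta> \<le> \<eta> \<bullet> x + y"
  unfolding support_def using cINF_lower[OF bdd, of "(x, y)" \<eta>] by (simp add: inner_Pair)

lemma support_ge: "(\<And>x y. (x, y) \<in> K \<Longrightarrow> c \<le> \<eta> \<bullet> x + y) \<Longrightarrow> c \<le> support \<eta>"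
  unfolding support_def using nonempty by (intro cINF_greatest) (auto simp: inner_Pair)

text \<open>The fibre over \<open>x\<close> is compact and nonempty, so it contains its
  infimum.\<close>

lemma lower_boundary_in:
  assumes "x \<in> fst ` K" shows "(x, lower_boundary K x) \<in> K"
proof -
  have "{y. (x, y) \<in> K} = snd ` (K \<inter> {x} \<times> UNIV)" by force
  moreover have "compact (K \<inter> {x} \<times> UNIV)"
    by (intro compact_Int_closed cpt closed_Times) auto
  ultimately have "compact {y. (x, y) \<in> K}"
    by (auto intro!: compact_continuous_image continuous_intros)
  moreover have "{y. (x, y) \<in> K} \<noteq> {}" using assms by force
  ultimately have "Inf {y. (x, y) \<in> K} \<in> {y. (x, y) \<in> K}"
    by (intro closed_contains_Inf bounded_imp_bdd_below compact_imp_bounded compact_imp_closed)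
  then show ?thesis by (simp add: lower_boundary_def)
qed

lemma lower_boundary_le: "(x, y) \<in> K \<Longrightarrow> lower_boundary K x \<le> y"
proof -
  assume xy: "(x, y) \<in> K"
  have "{y. (x, y) \<in> K} \<subseteq> snd ` K" by force
  moreover have "bdd_below (snd ` K)"
    by (intro bounded_imp_bdd_below compact_imp_bounded compact_continuous_image cpt continuous_intros)
  ultimately have "bdd_below {y. (x, y) \<in> K}" by (rule bdd_below_mono[rotated])
  then show ?thesis using xy by (simp add: lower_boundary_def cInf_lower)
qed

lemma convex_on_lower_boundary: "convex_on (fst ` K) (lower_boundary K)"
proof (rule convex_onI)
  show "convex (fst ` K)" using cvx by (simp add: convex_linear_image linear_fst)
  fix t x y assume t: "0 < t" "t < (1::real)" and "x \<in> fst ` K" "y \<in> fst ` K"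
  then have "(1 - t) *\<^sub>R (x, lower_boundary K x) + t *\<^sub>R (y, lower_boundary K y) \<in> K"
    using cvx t by (intro convexD_alt lower_boundary_in) auto
  then show "lower_boundary K ((1 - t) *\<^sub>R x + t *\<^sub>R y) \<le> (1 - t) * lower_boundary K x + t * lower_boundary K y"
    by (intro lower_boundary_le) simp
qed

lemma normal_directions_iff: "\<eta> \<in> normal_directions K P \<longleftrightarrow> support \<eta> = \<eta> \<bullet> P + lower_boundary K P"
  by (auto simp: normal_directions_def support_def inner_Pair)

lemma support_le_lower_boundary: "x \<in> fst ` K \<Longrightarrow> support \<eta> - \<eta> \<bullet> x \<le> lower_boundary K x"
  using support_le[OF lower_boundary_in, of x \<eta>] by simp

lemma normal_directions_subgradient:
  assumes P: "P \<in> fst ` K"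
  shows "\<eta> \<in> normal_directions K P \<longleftrightarrow>
    (\<forall>x\<in>fst ` K. lower_boundary K P + \<eta> \<bullet> P \<le> lower_boundary K x + \<eta> \<bullet> x)" (is "_ \<longleftrightarrow> ?R")
proof
  assume "\<eta> \<in> normal_directions K P"
  then show ?R using support_le_lower_boundary[of _ \<eta>] by (fastforce simp: normal_directions_iff)
next
  assume R: ?R
  have "\<eta> \<bullet> P + lower_boundary K P \<le> support \<eta>"
  proof (rule support_ge)
    fix x y assume xy: "(x, y) \<in> K"
    then have "lower_boundary K P + \<eta> \<bullet> P \<le> lower_boundary K x + \<eta> \<bullet> x" using R by force
    then show "\<eta> \<bullet> P + lower_boundary K P \<le> \<eta> \<bullet> x + y" using lower_boundary_le[OF xy] by simp
  qed
  then show "\<eta> \<in> normal_directions K P"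
    using support_le_lower_boundary[OF P, of \<eta>] by (simp add: normal_directions_iff)
qed

text \<open>The lower boundary is dominated by its biconjugate, which is infinite off the projection.\<close>

lemma biconjugate_bound:
  assumes v: "\<And>\<eta>. support \<eta> - \<eta> \<bullet> P \<le> v"
  shows "P \<in> fst ` K" "lower_boundary K P \<le> v"
proof -
  show P: "P \<in> fst ` K"
  proof (rule ccontr)
    assume "P \<notin> fst ` K"
    moreover have "convex (fst ` K)" using cvx by (simp add: convex_linear_image linear_fst)
    moreover have "closed (fst ` K)"
      by (intro compact_imp_closed compact_continuous_image cpt continuous_intros)
    ultimately have "\<exists>a b. a \<bullet> P < b \<and> (\<forall>x\<in>fst ` K. b < a \<bullet> x)"
      by (intro separating_hyperplane_closed_point)
    then obtain a b where ab: "a \<bullet> P < b" "\<And>x. x \<in> fst ` K \<Longrightarrow> b < a \<bullet> x"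
      by blast
    \<comment> \<open>Going far along a direction \<open>a\<close> that strictly separates
      \<open>P\<close> from the projection makes \<open>support \<eta> - \<eta> \<bullet> P\<close>
      arbitrarily large.\<close>
    have "support 0 \<le> support (t *\<^sub>R a) - t * b" if "t \<ge> 0" for t
    proof -
      have "support 0 + t * b \<le> support (t *\<^sub>R a)"
      proof (rule support_ge)
        fix x y assume xy: "(x, y) \<in> K"
        then have "b \<le> a \<bullet> x" using ab(2)[of x] by force
        then have "t * b \<le> t * (a \<bullet> x)" using that by (rule mult_left_mono)
        then show "support 0 + t * b \<le> (t *\<^sub>R a) \<bullet> x + y"
          using support_le[OF xy, of 0] by simp
      qed
      then show ?thesis by simp
    qed
    then have le: "support 0 + t * (b - a \<bullet> P) \<le> v" if "t \<ge> 0" for t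
      using v[of "t *\<^sub>R a"] that by (force simp: algebra_simps)
    \<comment> \<open>Large enough that the lower bound in \<open>le\<close> reaches at least
      \<open>v + 1\<close>.\<close>
    define t where "t = (\<bar>v - support 0\<bar> + 1) / (b - a \<bullet> P)"
    have "t \<ge> 0" "t * (b - a \<bullet> P) = \<bar>v - support 0\<bar> + 1"
      using ab(1) by (auto simp: t_def)
    then show False using le[of t] by linarith
  qed
  show "lower_boundary K P \<le> v"
  proof (rule ccontr)
    assume "\<not> lower_boundary K P \<le> v"
    then have "v < lower_boundary K P" by simp
    then have "(P, v) \<notin> K" using lower_boundary_le by force
    then have "\<exists>z r. z \<bullet> (P, v) < r \<and> (\<forall>x\<in>K. r < z \<bullet> x)"
      by (intro separating_hyperplane_closed_point cvx compact_imp_closed[OF cpt])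
    then obtain z r where zr: "z \<bullet> (P, v) < r" "\<And>x. x \<in> K \<Longrightarrow> r < z \<bullet> x"
      by blast
    obtain a b where z: "z = (a, b)" by fastforce
    \<comment> \<open>Comparing \<open>(P, v)\<close> with the point of \<open>K\<close> directly
      above it shows that the separating hyperplane is not vertical; dividing by \<open>b\<close>
      then gives a direction with last coordinate 1, as \<open>support\<close> requires.\<close>
    have "a \<bullet> P + b * v < a \<bullet> P + b * lower_boundary K P"
      using zr(1) zr(2)[OF lower_boundary_in[OF P]] by (simp add: z inner_Pair)
    then have "b > 0" using \<open>v < lower_boundary K P\<close> by (simp add: mult_less_cancel_left)
    have "r / b \<le> support (a /\<^sub>R b)"
    proof (rule support_ge)
      fix x y assume "(x, y) \<in> K"
      then have "r < a \<bullet> x + b * y" using zr(2)[of "(x, y)"] by (simp add: z inner_Pair)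
      then show "r / b \<le> (a /\<^sub>R b) \<bullet> x + y" using \<open>b > 0\<close> by (simp add: field_simps)
    qed
    moreover have "(a \<bullet> P + b * v) / b < r / b"
      using zr(1) \<open>b > 0\<close> by (intro divide_strict_right_mono) (simp_all add: z inner_Pair)
    moreover have "(a /\<^sub>R b) \<bullet> P = (a \<bullet> P) / b"
      by (simp add: divide_inverse mult.commute)
    moreover have "(a \<bullet> P + b * v) / b = (a \<bullet> P) / b + v"
      using \<open>b > 0\<close> by (simp add: add_divide_distrib)
    ultimately show False using v[of "a /\<^sub>R b"] by simp
  qed
qed

end

section \<open>Expectations, mixtures and determining sets\<close>

lemma ac_prob_measuresD:
  assumes "Q \<in> ac_prob_measures M"
  shows "prob_space Q" "sets Q = sets M" "absolutely_continuous M Q"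
    "borel_measurable Q = borel_measurable M"
  using assms by (auto simp: ac_prob_measures_def cong: measurable_cong_sets)

lemma expct_nn_integral:
  "expct Q X = (if (\<integral>\<^sup>+ \<omega>. ennreal (- X \<omega>) \<partial>Q) = \<infinity> then - \<infinity>
     else enn2ereal (\<integral>\<^sup>+ \<omega>. ennreal (X \<omega>) \<partial>Q) - enn2ereal (\<integral>\<^sup>+ \<omega>. ennreal (- X \<omega>) \<partial>Q))"
proof -
  have "ennreal (max 0 x) = ennreal x" for x :: real by (simp add: max_def ennreal_neg)
  then show ?thesis by (simp add: expct_def)
qed

lemma expct_integrable:
  assumes "integrable Q X"
  shows "expct Q X = ereal (\<integral>\<omega>. X \<omega> \<partial>Q)"
proof -
  have "(\<integral>\<^sup>+ \<omega>. ennreal (X \<omega>) \<partial>Q) \<noteq> \<infinity>" "(\<integral>\<^sup>+ \<omega>. ennreal (- X \<omega>) \<partial>Q) \<noteq> \<infinity>"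
    using assms by (auto simp: real_integrable_def)
  then show ?thesis
    by (cases "\<integral>\<^sup>+ \<omega>. ennreal (X \<omega>) \<partial>Q"; cases "\<integral>\<^sup>+ \<omega>. ennreal (- X \<omega>) \<partial>Q")
      (auto simp: expct_nn_integral real_lebesgue_integral_def[OF assms] enn2ereal_ennreal)
qed

text \<open>One subadditivity estimate is applied twice, the second time to \<open>X\<close> written
  as \<open>- Y\<close> plus \<open>Y + X\<close>.\<close>

lemma nn_integral_add_integrable_eq_top_iff:
  fixes X Y :: "'a \<Rightarrow> real"
  assumes Y: "integrable Q Y" and X: "X \<in> borel_measurable Q"
  shows "(\<integral>\<^sup>+ \<omega>. ennreal (Y \<omega> + X \<omega>) \<partial>Q) = \<infinity> \<longleftrightarrow> (\<integral>\<^sup>+ \<omega>. ennreal (X \<omega>) \<partial>Q) = \<infinity>"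
proof -
  have le: "(\<integral>\<^sup>+ \<omega>. ennreal (Z \<omega> + V \<omega>) \<partial>Q) \<le> (\<integral>\<^sup>+ \<omega>. ennreal (norm (Z \<omega>)) \<partial>Q) + (\<integral>\<^sup>+ \<omega>. ennreal (V \<omega>) \<partial>Q)"
    if "integrable Q Z" "V \<in> borel_measurable Q" for Z V :: "'a \<Rightarrow> real"
  proof -
    have "ennreal (z + v) \<le> ennreal (norm z) + ennreal v" for z v :: real
      by (cases "v \<ge> 0") (auto simp: ennreal_plus[symmetric] ennreal_neg simp del: ennreal_plus intro!: ennreal_leI)
    then have "(\<integral>\<^sup>+ \<omega>. ennreal (Z \<omega> + V \<omega>) \<partial>Q) \<le> (\<integral>\<^sup>+ \<omega>. ennreal (norm (Z \<omega>)) + ennreal (V \<omega>) \<partial>Q)"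
      by (intro nn_integral_mono)
    also have "\<dots> = (\<integral>\<^sup>+ \<omega>. ennreal (norm (Z \<omega>)) \<partial>Q) + (\<integral>\<^sup>+ \<omega>. ennreal (V \<omega>) \<partial>Q)"
      using that by (intro nn_integral_add) auto
    finally show ?thesis .
  qed
  have fin: "(\<integral>\<^sup>+ \<omega>. ennreal (norm (Y \<omega>)) \<partial>Q) < \<infinity>"
    using Y by (simp add: integrable_iff_bounded)
  show ?thesis
    using le[OF Y X] le[of "\<lambda>\<omega>. - Y \<omega>" "\<lambda>\<omega>. Y \<omega> + X \<omega>"] fin X Y
    by (auto simp: top_unique less_top ennreal_add_eq_top)
qed

text \<open>An integrable shift does not change which of the two parts is infinite, so additivity
  survives the convention for \<infinity> - \<infinity>. This is what allows non-integrable members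
  of \<open>A\<close>.\<close>

lemma expct_add:
  assumes Y: "integrable Q Y" and X: "X \<in> borel_measurable Q"
  shows "expct Q (\<lambda>\<omega>. Y \<omega> + X \<omega>) = ereal (\<integral>\<omega>. Y \<omega> \<partial>Q) + expct Q X"
proof -
  have pos: "(\<integral>\<^sup>+ \<omega>. ennreal (Y \<omega> + X \<omega>) \<partial>Q) = \<infinity> \<longleftrightarrow> (\<integral>\<^sup>+ \<omega>. ennreal (X \<omega>) \<partial>Q) = \<infinity>"
    by (rule nn_integral_add_integrable_eq_top_iff) fact+
  have neg: "(\<integral>\<^sup>+ \<omega>. ennreal (- (Y \<omega> + X \<omega>)) \<partial>Q) = \<infinity> \<longleftrightarrow> (\<integral>\<^sup>+ \<omega>. ennreal (- X \<omega>) \<partial>Q) = \<infinity>"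
    using nn_integral_add_integrable_eq_top_iff[of Q "\<lambda>\<omega>. - Y \<omega>" "\<lambda>\<omega>. - X \<omega>"] X Y by simp
  consider "(\<integral>\<^sup>+ \<omega>. ennreal (- X \<omega>) \<partial>Q) = \<infinity>"
    | "(\<integral>\<^sup>+ \<omega>. ennreal (- X \<omega>) \<partial>Q) \<noteq> \<infinity>" "(\<integral>\<^sup>+ \<omega>. ennreal (X \<omega>) \<partial>Q) = \<infinity>"
    | "integrable Q X"
    using X by (auto simp: real_integrable_def)
  then show ?thesis
  proof cases
    case 1
    then show ?thesis using neg by (simp add: expct_nn_integral)
  next
    case 2
    then have "(\<integral>\<^sup>+ \<omega>. ennreal (- (Y \<omega> + X \<omega>)) \<partial>Q) \<noteq> \<infinity>" "(\<integral>\<^sup>+ \<omega>. ennreal (Y \<omega> + X \<omega>) \<partial>Q) = \<infinity>"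
      using pos neg by auto
    with 2 show ?thesis unfolding expct_nn_integral
      by (cases "\<integral>\<^sup>+ \<omega>. ennreal (- X \<omega>) \<partial>Q"; cases "\<integral>\<^sup>+ \<omega>. ennreal (- (Y \<omega> + X \<omega>)) \<partial>Q")
        (auto simp: enn2ereal_ennreal)
  next
    case 3
    then show ?thesis using Y by (simp add: expct_integrable)
  qed
qed

section \<open>Mixtures of probability measures\<close>

text \<open>A relation rather than an operation: \<open>R\<close> is described by its integrals of
  nonnegative functions, without fixing a density.\<close>

definition mixture :: "'a measure \<Rightarrow> real \<Rightarrow> 'a measure \<Rightarrow> 'a measure \<Rightarrow> 'a measure \<Rightarrow> bool" where
  "mixture M t Q1 Q2 R \<longleftrightarrow> R \<in> ac_prob_measures M \<and> (\<forall>f\<in>borel_measurable M.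
     (\<integral>\<^sup>+\<omega>. f \<omega> \<partial>R) = ennreal (1 - t) * (\<integral>\<^sup>+\<omega>. f \<omega> \<partial>Q1) + ennreal t * (\<integral>\<^sup>+\<omega>. f \<omega> \<partial>Q2))"

lemma (in prob_space) mixture_exists:
  assumes Q1: "Q1 \<in> ac_prob_measures M" and Q2: "Q2 \<in> ac_prob_measures M" and t: "0 < t" "t < 1"
  shows "\<exists>R. mixture M t Q1 Q2 R"
proof -
  note 1 = ac_prob_measuresD[OF Q1] and 2 = ac_prob_measuresD[OF Q2]
  let ?z = "\<lambda>\<omega>. ennreal (1 - t) * RN_deriv M Q1 \<omega> + ennreal t * RN_deriv M Q2 \<omega>"
  let ?R = "density M ?z"
  have eq: "(\<integral>\<^sup>+\<omega>. f \<omega> \<partial>?R) = ennreal (1 - t) * (\<integral>\<^sup>+\<omega>. f \<omega> \<partial>Q1) + ennreal t * (\<integral>\<^sup>+\<omega>. f \<omega> \<partial>Q2)"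
    if [measurable]: "f \<in> borel_measurable M" for f
  proof -
    have "(\<integral>\<^sup>+\<omega>. f \<omega> \<partial>?R) = (\<integral>\<^sup>+\<omega>. ennreal (1 - t) * (RN_deriv M Q1 \<omega> * f \<omega>) + ennreal t * (RN_deriv M Q2 \<omega> * f \<omega>) \<partial>M)"
      by (subst nn_integral_density) (auto simp: distrib_right mult.assoc)
    also have "\<dots> = ennreal (1 - t) * (\<integral>\<^sup>+\<omega>. RN_deriv M Q1 \<omega> * f \<omega> \<partial>M) + ennreal t * (\<integral>\<^sup>+\<omega>. RN_deriv M Q2 \<omega> * f \<omega> \<partial>M)"
      by (simp add: nn_integral_add nn_integral_cmult)
    finally show ?thesis
      using RN_deriv_nn_integral[OF 1(3,2) that] RN_deriv_nn_integral[OF 2(3,2) that] by simp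
  qed
  have "emeasure ?R (space ?R) = (\<integral>\<^sup>+\<omega>. 1 \<partial>?R)" by simp
  also have "\<dots> = ennreal (1 - t) + ennreal t"
    using eq[of "\<lambda>_. 1"] 1(1) 2(1) by (simp add: prob_space.emeasure_space_1)
  also have "\<dots> = 1" using t by (simp add: ennreal_plus[symmetric] del: ennreal_plus)
  finally have "prob_space ?R" by (rule prob_spaceI)
  then have "?R \<in> ac_prob_measures M"
    by (auto simp: ac_prob_measures_def intro!: absolutely_continuousI_density)
  with eq show ?thesis by (auto simp: mixture_def)
qed

lemma mixture_integral:
  fixes X :: "'a \<Rightarrow> real"
  assumes mix: "mixture M t Q1 Q2 R" and t: "0 < t" "t < 1" and X: "X \<in> borel_measurable M"
    and X1: "integrable Q1 X" and X2: "integrable Q2 X"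
  shows "integrable R X" "(\<integral>\<omega>. X \<omega> \<partial>R) = (1 - t) * (\<integral>\<omega>. X \<omega> \<partial>Q1) + t * (\<integral>\<omega>. X \<omega> \<partial>Q2)"
proof -
  have R: "borel_measurable R = borel_measurable M"
    using mix by (intro ac_prob_measuresD(4)) (simp add: mixture_def)
  have eq: "(\<integral>\<^sup>+\<omega>. ennreal (f \<omega>) \<partial>R) = ennreal (1 - t) * (\<integral>\<^sup>+\<omega>. ennreal (f \<omega>) \<partial>Q1) + ennreal t * (\<integral>\<^sup>+\<omega>. ennreal (f \<omega>) \<partial>Q2)"
    if "f \<in> borel_measurable M" for f :: "'a \<Rightarrow> real"
    using mix that by (auto simp: mixture_def)
  have p: "(\<integral>\<^sup>+\<omega>. ennreal (X \<omega>) \<partial>R) = ennreal (1 - t) * (\<integral>\<^sup>+\<omega>. ennreal (X \<omega>) \<partial>Q1) + ennreal t * (\<integral>\<^sup>+\<omega>. ennreal (X \<omega>) \<partial>Q2)"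
    and m: "(\<integral>\<^sup>+\<omega>. ennreal (- X \<omega>) \<partial>R) = ennreal (1 - t) * (\<integral>\<^sup>+\<omega>. ennreal (- X \<omega>) \<partial>Q1) + ennreal t * (\<integral>\<^sup>+\<omega>. ennreal (- X \<omega>) \<partial>Q2)"
    using eq[of X] eq[of "\<lambda>\<omega>. - X \<omega>"] X by auto
  note fin = X1[unfolded real_integrable_def] X2[unfolded real_integrable_def]
  show int: "integrable R X"
    unfolding real_integrable_def p m using fin X R
    by (auto simp: ennreal_mult_eq_top_iff ennreal_add_eq_top)
  have e2r: "enn2real (ennreal (1 - t) * a + ennreal t * b) = (1 - t) * enn2real a + t * enn2real b"
    if "a \<noteq> \<infinity>" "b \<noteq> \<infinity>" for a b
    using that t by (cases a; cases b) (auto simp: ennreal_mult[symmetric] ennreal_plus[symmetric] simp del: ennreal_plus)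
  show "(\<integral>\<omega>. X \<omega> \<partial>R) = (1 - t) * (\<integral>\<omega>. X \<omega> \<partial>Q1) + t * (\<integral>\<omega>. X \<omega> \<partial>Q2)"
    unfolding real_lebesgue_integral_def[OF int] real_lebesgue_integral_def[OF X1]
      real_lebesgue_integral_def[OF X2] p m
    using fin by (subst (1 2) e2r) (auto simp: algebra_simps)
qed

text \<open>Only a bound by the minimum is claimed, which avoids arithmetic with infinite values: an
  infinite negative part on the right-hand mixture makes the minimum -\<infinity>, and if only the
  positive part under \<open>R\<close> is infinite then the right side is \<infinity>. Otherwise all
  integrals are finite and the expectation is affine.\<close>

lemma mixture_expct:
  assumes mix: "mixture M t Q1 Q2 R" and t: "0 < t" "t < 1" and X: "X \<in> borel_measurable M"
    and Q: "Q1 \<in> ac_prob_measures M" "Q2 \<in> ac_prob_measures M"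
  shows "min (expct Q1 X) (expct Q2 X) \<le> expct R X"
proof -
  have R: "borel_measurable R = borel_measurable M"
    using mix by (intro ac_prob_measuresD(4)) (simp add: mixture_def)
  have eq: "(\<integral>\<^sup>+\<omega>. ennreal (f \<omega>) \<partial>R) = ennreal (1 - t) * (\<integral>\<^sup>+\<omega>. ennreal (f \<omega>) \<partial>Q1) + ennreal t * (\<integral>\<^sup>+\<omega>. ennreal (f \<omega>) \<partial>Q2)"
    if "f \<in> borel_measurable M" for f :: "'a \<Rightarrow> real"
    using mix that by (auto simp: mixture_def)
  note p = eq[OF X] and m = eq[OF borel_measurable_uminus[OF X]]
  consider "(\<integral>\<^sup>+\<omega>. ennreal (- X \<omega>) \<partial>Q1) = \<infinity>" | "(\<integral>\<^sup>+\<omega>. ennreal (- X \<omega>) \<partial>Q2) = \<infinity>"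
    | "(\<integral>\<^sup>+\<omega>. ennreal (- X \<omega>) \<partial>R) \<noteq> \<infinity>" "(\<integral>\<^sup>+\<omega>. ennreal (X \<omega>) \<partial>R) = \<infinity>"
    | "integrable Q1 X" "integrable Q2 X"
    using X t unfolding real_integrable_def p m ac_prob_measuresD(4)[OF Q(1)] ac_prob_measuresD(4)[OF Q(2)]
    by (auto simp: ennreal_mult_eq_top_iff ennreal_add_eq_top)
  then show ?thesis
  proof cases
    case 3
    then have "expct R X = \<infinity>"
      by (cases "\<integral>\<^sup>+\<omega>. ennreal (- X \<omega>) \<partial>R") (auto simp: expct_nn_integral enn2ereal_ennreal)
    then show ?thesis by simp
  next
    case 4
    have "min a b \<le> (1 - t) * a + t * b" for a b :: real
    proof -
      have "(1 - t) * min a b + t * min a b \<le> (1 - t) * a + t * b"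
        using t by (intro add_mono mult_left_mono) auto
      then show ?thesis by (simp add: algebra_simps)
    qed
    then show ?thesis
      using mixture_integral[OF mix t X 4] 4 by (simp add: expct_integrable ereal_min[symmetric] del: ereal_min)
  qed (simp_all add: expct_nn_integral)
qed

section \<open>Greatest representing sets and their convexity\<close>

lemma determining_set_greatest:
  fixes M :: "'a measure"
  assumes "coherent_utility M u"
  shows "represents M (determining_set M u) u"
    and "represents M D u \<Longrightarrow> D \<subseteq> determining_set M u"
proof -
  let ?U = "\<Union>{D. represents M D u}"
  obtain D0 where D0: "represents M D0 u" using assms by (auto simp: coherent_utility_def)
  have "u X = (INF Q\<in>?U. expct Q X)" if X: "X \<in> borel_measurable M" for X :: "'a \<Rightarrow> real"
  proof (rule antisym)
    show "u X \<le> (INF Q\<in>?U. expct Q X)"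
    proof (rule INF_greatest)
      fix Q assume "Q \<in> ?U"
      then obtain D where "Q \<in> D" "represents M D u" by blast
      then show "u X \<le> expct Q X" using X by (auto simp: represents_def intro: INF_lower)
    qed
    have "(INF Q\<in>?U. expct Q X) \<le> (INF Q\<in>D0. expct Q X)"
      using D0 by (intro INF_superset_mono) auto
    then show "(INF Q\<in>?U. expct Q X) \<le> u X" using D0 X by (simp add: represents_def)
  qed
  moreover have "?U \<noteq> {}" "?U \<subseteq> ac_prob_measures M"
    using D0 unfolding represents_def by blast+
  ultimately have U: "represents M ?U u" unfolding represents_def by blast
  then have "determining_set M u = ?U"
    unfolding determining_set_def by (intro Greatest_equality) auto
  then show "represents M (determining_set M u) u"
    and "represents M D u \<Longrightarrow> D \<subseteq> determining_set M u" using U by auto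
qed

text \<open>Adjoining a mixture leaves every infimum unchanged, so the enlarged set still represents
  \<open>u\<close>; maximality then says that the mixture was a member already.\<close>

lemma (in prob_space) determining_set_mixture:
  assumes u: "coherent_utility M u" and Q: "Q1 \<in> determining_set M u" "Q2 \<in> determining_set M u"
    and t: "0 < t" "t < 1"
  shows "\<exists>R\<in>determining_set M u. mixture M t Q1 Q2 R"
proof -
  let ?D = "determining_set M u"
  note rep = determining_set_greatest(1)[OF u]
  have ac: "?D \<subseteq> ac_prob_measures M" using rep by (simp add: represents_def)
  obtain R where R: "mixture M t Q1 Q2 R" using mixture_exists[OF _ _ t] Q ac by blast
  have "represents M (insert R ?D) u"
    unfolding represents_def
  proof (intro conjI ballI)
    show "insert R ?D \<subseteq> ac_prob_measures M" using ac R by (simp add: mixture_def)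
    fix X :: "'a \<Rightarrow> real" assume X: "X \<in> borel_measurable M"
    have "(INF Q\<in>?D. expct Q X) \<le> min (expct Q1 X) (expct Q2 X)"
      using Q by (auto intro: INF_lower)
    also have "\<dots> \<le> expct R X" using Q ac by (intro mixture_expct[OF R t X]) auto
    finally have "(INF Q\<in>insert R ?D. expct Q X) = (INF Q\<in>?D. expct Q X)"
      by (simp add: inf_absorb2)
    then show "u X = (INF Q\<in>insert R ?D. expct Q X)" using rep X by (simp add: represents_def)
  qed simp
  then show ?thesis using determining_set_greatest(2)[OF u] R by blast
qed

section \<open>Weak compactness\<close>

text \<open>
  This class contains \<^term>\<open>L1s M D\<close>, and unlike there closure under sums is immediate; it is all
  that is needed for \<open>Q \<mapsto> E\<^sub>Q X\<close> to be weakly continuous on \<^term>\<open>D\<close>.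
\<close>

definition bounded_approx :: "'a measure \<Rightarrow> 'a measure set \<Rightarrow> ('a \<Rightarrow> real) set" where
  "bounded_approx M D = {X \<in> borel_measurable M. \<forall>\<epsilon>>0. \<exists>g\<in>borel_measurable M.
     (\<exists>C. \<forall>\<omega>. \<bar>g \<omega>\<bar> \<le> C) \<and> (\<forall>Q\<in>D. (\<integral>\<^sup>+\<omega>. ennreal \<bar>X \<omega> - g \<omega>\<bar> \<partial>Q) \<le> ennreal \<epsilon>)}"

lemma bounded_approxE:
  assumes "X \<in> bounded_approx M D" "\<epsilon> > 0"
  obtains g C where "g \<in> borel_measurable M" "\<And>\<omega>. \<bar>g \<omega>\<bar> \<le> C"
    "\<And>Q. Q \<in> D \<Longrightarrow> (\<integral>\<^sup>+\<omega>. ennreal \<bar>X \<omega> - g \<omega>\<bar> \<partial>Q) \<le> ennreal \<epsilon>"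
  using assms unfolding bounded_approx_def by blast

lemma bounded_approx_measurable: "X \<in> bounded_approx M D \<Longrightarrow> X \<in> borel_measurable M"
  by (simp add: bounded_approx_def)

lemma L1s_subset_bounded_approx: "L1s M D \<subseteq> bounded_approx M D"
proof
  fix X assume "X \<in> L1s M D"
  then have [measurable]: "X \<in> borel_measurable M"
    and lim: "(\<lambda>n::nat. SUP Q\<in>D. \<integral>\<^sup>+ \<omega>. ennreal (\<bar>X \<omega>\<bar> * indicator {\<omega>. \<bar>X \<omega>\<bar> > real n} \<omega>) \<partial>Q) \<longlonglongrightarrow> 0"
    by (auto simp: L1s_def)
  have "\<exists>g\<in>borel_measurable M. (\<exists>C. \<forall>\<omega>. \<bar>g \<omega>\<bar> \<le> C) \<and> (\<forall>Q\<in>D. (\<integral>\<^sup>+\<omega>. ennreal \<bar>X \<omega> - g \<omega>\<bar> \<partial>Q) \<le> ennreal \<epsilon>)"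
    if \<epsilon>: "\<epsilon> > 0" for \<epsilon>
  proof -
    obtain n :: nat where n: "(SUP Q\<in>D. \<integral>\<^sup>+ \<omega>. ennreal (\<bar>X \<omega>\<bar> * indicator {\<omega>. \<bar>X \<omega>\<bar> > real n} \<omega>) \<partial>Q) < ennreal \<epsilon>"
      using eventually_happens'[OF sequentially_bot order_tendstoD(2)[OF lim, of "ennreal \<epsilon>"]] \<epsilon>
      by auto
    \<comment> \<open>Truncating to 0, rather than to the level \<open>n\<close>, makes the error
      \<open>\<bar>X - g\<bar>\<close> exactly the tail integrand of \<open>L1s\<close>.\<close>
    define g where "g \<omega> = (if \<bar>X \<omega>\<bar> > real n then 0 else X \<omega>)" for \<omega>
    have "g \<in> borel_measurable M" unfolding g_def by measurable
    moreover have "\<forall>\<omega>. \<bar>g \<omega>\<bar> \<le> real n" by (auto simp: g_def)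
    moreover have "(\<integral>\<^sup>+\<omega>. ennreal \<bar>X \<omega> - g \<omega>\<bar> \<partial>Q) \<le> ennreal \<epsilon>" if "Q \<in> D" for Q
    proof -
      have "(\<lambda>\<omega>. \<bar>X \<omega> - g \<omega>\<bar>) = (\<lambda>\<omega>. \<bar>X \<omega>\<bar> * indicator {\<omega>. \<bar>X \<omega>\<bar> > real n} \<omega>)"
        by (auto simp: g_def)
      then have "(\<integral>\<^sup>+\<omega>. ennreal \<bar>X \<omega> - g \<omega>\<bar> \<partial>Q) = (\<integral>\<^sup>+ \<omega>. ennreal (\<bar>X \<omega>\<bar> * indicator {\<omega>. \<bar>X \<omega>\<bar> > real n} \<omega>) \<partial>Q)"
        by metis
      also have "\<dots> \<le> (SUP Q\<in>D. \<integral>\<^sup>+ \<omega>. ennreal (\<bar>X \<omega>\<bar> * indicator {\<omega>. \<bar>X \<omega>\<bar> > real n} \<omega>) \<partial>Q)"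
        using that by (intro SUP_upper)
      finally show ?thesis using n by simp
    qed
    ultimately show ?thesis by blast
  qed
  then show "X \<in> bounded_approx M D" by (simp add: bounded_approx_def)
qed

lemma bounded_approx_cmult:
  assumes X: "X \<in> bounded_approx M D" and D: "D \<subseteq> ac_prob_measures M"
  shows "(\<lambda>\<omega>. c * X \<omega>) \<in> bounded_approx M D"
proof -
  have "\<exists>g\<in>borel_measurable M. (\<exists>C. \<forall>\<omega>. \<bar>g \<omega>\<bar> \<le> C) \<and> (\<forall>Q\<in>D. (\<integral>\<^sup>+\<omega>. ennreal \<bar>c * X \<omega> - g \<omega>\<bar> \<partial>Q) \<le> ennreal \<epsilon>)"
    if "\<epsilon> > 0" for \<epsilon>
  proof -
    \<comment> \<open>The added 1 covers \<open>c = 0\<close> as well.\<close>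
    have "\<epsilon> / (\<bar>c\<bar> + 1) > 0" using that by simp
    from bounded_approxE[OF X this] obtain g C where g: "g \<in> borel_measurable M" "\<And>\<omega>. \<bar>g \<omega>\<bar> \<le> C"
      "\<And>Q. Q \<in> D \<Longrightarrow> (\<integral>\<^sup>+\<omega>. ennreal \<bar>X \<omega> - g \<omega>\<bar> \<partial>Q) \<le> ennreal (\<epsilon> / (\<bar>c\<bar> + 1))" by blast
    have "(\<lambda>\<omega>. c * g \<omega>) \<in> borel_measurable M" using g by simp
    moreover have "\<forall>\<omega>. \<bar>c * g \<omega>\<bar> \<le> \<bar>c\<bar> * C" using g(2) by (auto simp: abs_mult intro: mult_left_mono)
    moreover have "(\<integral>\<^sup>+\<omega>. ennreal \<bar>c * X \<omega> - c * g \<omega>\<bar> \<partial>Q) \<le> ennreal \<epsilon>" if Q: "Q \<in> D" for Q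
    proof -
      have [measurable_cong]: "sets Q = sets M"
        using Q D by (intro ac_prob_measuresD(2)) auto
      note [measurable] = bounded_approx_measurable[OF X] g(1)
      have "(\<integral>\<^sup>+\<omega>. ennreal \<bar>c * X \<omega> - c * g \<omega>\<bar> \<partial>Q) = (\<integral>\<^sup>+\<omega>. ennreal \<bar>c\<bar> * ennreal \<bar>X \<omega> - g \<omega>\<bar> \<partial>Q)"
        by (simp add: ennreal_mult[symmetric] abs_mult[symmetric] right_diff_distrib)
      also have "\<dots> = ennreal \<bar>c\<bar> * (\<integral>\<^sup>+\<omega>. ennreal \<bar>X \<omega> - g \<omega>\<bar> \<partial>Q)"
        by (intro nn_integral_cmult) measurable
      also have "\<dots> \<le> ennreal \<bar>c\<bar> * ennreal (\<epsilon> / (\<bar>c\<bar> + 1))"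
        using g(3)[OF Q] by (rule mult_left_mono) simp
      also have "\<dots> = ennreal (\<bar>c\<bar> * (\<epsilon> / (\<bar>c\<bar> + 1)))"
        using \<open>\<epsilon> > 0\<close> by (intro ennreal_mult[symmetric]) auto
      also have "\<dots> \<le> ennreal \<epsilon>"
        using \<open>\<epsilon> > 0\<close> by (intro ennreal_leI) (simp add: pos_divide_le_eq mult.commute mult_left_mono)
      finally show ?thesis .
    qed
    ultimately show ?thesis by (intro bexI[of _ "\<lambda>\<omega>. c * g \<omega>"]) blast
  qed
  then show ?thesis using bounded_approx_measurable[OF X] by (simp add: bounded_approx_def)
qed

lemma bounded_approx_add:
  assumes X: "X \<in> bounded_approx M D" and Y: "Y \<in> bounded_approx M D" and D: "D \<subseteq> ac_prob_measures M"
  shows "(\<lambda>\<omega>. X \<omega> + Y \<omega>) \<in> bounded_approx M D"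
proof -
  have "\<exists>g\<in>borel_measurable M. (\<exists>C. \<forall>\<omega>. \<bar>g \<omega>\<bar> \<le> C) \<and> (\<forall>Q\<in>D. (\<integral>\<^sup>+\<omega>. ennreal \<bar>X \<omega> + Y \<omega> - g \<omega>\<bar> \<partial>Q) \<le> ennreal \<epsilon>)"
    if "\<epsilon> > 0" for \<epsilon>
  proof -
    have "\<epsilon> / 2 > 0" using that by simp
    from bounded_approxE[OF X this] obtain g C where g: "g \<in> borel_measurable M" "\<And>\<omega>. \<bar>g \<omega>\<bar> \<le> C"
      "\<And>Q. Q \<in> D \<Longrightarrow> (\<integral>\<^sup>+\<omega>. ennreal \<bar>X \<omega> - g \<omega>\<bar> \<partial>Q) \<le> ennreal (\<epsilon> / 2)" by blast
    from bounded_approxE[OF Y \<open>\<epsilon> / 2 > 0\<close>] obtain g' C' where g': "g' \<in> borel_measurable M" "\<And>\<omega>. \<bar>g' \<omega>\<bar> \<le> C'"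
      "\<And>Q. Q \<in> D \<Longrightarrow> (\<integral>\<^sup>+\<omega>. ennreal \<bar>Y \<omega> - g' \<omega>\<bar> \<partial>Q) \<le> ennreal (\<epsilon> / 2)" by blast
    have "(\<lambda>\<omega>. g \<omega> + g' \<omega>) \<in> borel_measurable M" using g g' by simp
    moreover have "\<forall>\<omega>. \<bar>g \<omega> + g' \<omega>\<bar> \<le> C + C'"
      using g(2) g'(2) by (meson abs_triangle_ineq add_mono order_trans)
    moreover have "(\<integral>\<^sup>+\<omega>. ennreal \<bar>X \<omega> + Y \<omega> - (g \<omega> + g' \<omega>)\<bar> \<partial>Q) \<le> ennreal \<epsilon>" if Q: "Q \<in> D" for Q
    proof -
      have [measurable_cong]: "sets Q = sets M"
        using Q D by (intro ac_prob_measuresD(2)) auto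
      note [measurable] = bounded_approx_measurable[OF X] bounded_approx_measurable[OF Y] g(1) g'(1)
      have "(\<integral>\<^sup>+\<omega>. ennreal \<bar>X \<omega> + Y \<omega> - (g \<omega> + g' \<omega>)\<bar> \<partial>Q)
          \<le> (\<integral>\<^sup>+\<omega>. ennreal \<bar>X \<omega> - g \<omega>\<bar> + ennreal \<bar>Y \<omega> - g' \<omega>\<bar> \<partial>Q)"
        by (intro nn_integral_mono) (auto simp: ennreal_plus[symmetric] simp del: ennreal_plus intro!: ennreal_leI)
      also have "\<dots> = (\<integral>\<^sup>+\<omega>. ennreal \<bar>X \<omega> - g \<omega>\<bar> \<partial>Q) + (\<integral>\<^sup>+\<omega>. ennreal \<bar>Y \<omega> - g' \<omega>\<bar> \<partial>Q)"
        by (intro nn_integral_add) measurable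
      also have "\<dots> \<le> ennreal (\<epsilon> / 2) + ennreal (\<epsilon> / 2)"
        using g(3)[OF Q] g'(3)[OF Q] by (rule add_mono)
      also have "\<dots> = ennreal \<epsilon>"
        using \<open>\<epsilon> > 0\<close> by (simp add: ennreal_plus[symmetric] del: ennreal_plus)
      finally show ?thesis .
    qed
    ultimately show ?thesis by (intro bexI[of _ "\<lambda>\<omega>. g \<omega> + g' \<omega>"]) blast
  qed
  then show ?thesis
    using bounded_approx_measurable[OF X] bounded_approx_measurable[OF Y] by (simp add: bounded_approx_def)
qed

lemma integral_close:
  fixes X g :: "'a \<Rightarrow> real"
  assumes Q: "Q \<in> ac_prob_measures M" and X: "X \<in> borel_measurable M"
    and g: "g \<in> borel_measurable M" "\<And>\<omega>. \<bar>g \<omega>\<bar> \<le> C"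
    and close: "(\<integral>\<^sup>+\<omega>. ennreal \<bar>X \<omega> - g \<omega>\<bar> \<partial>Q) \<le> ennreal \<epsilon>" and \<epsilon>: "\<epsilon> > 0"
  shows "integrable Q X" "integrable Q g" "\<bar>(\<integral>\<omega>. X \<omega> \<partial>Q) - (\<integral>\<omega>. g \<omega> \<partial>Q)\<bar> \<le> \<epsilon>"
proof -
  interpret Q: prob_space Q by (rule ac_prob_measuresD(1)[OF Q])
  have [simp]: "borel_measurable Q = borel_measurable M"
    using Q by (rule ac_prob_measuresD(4))
  show ig: "integrable Q g"
    using g by (intro Q.integrable_const_bound[of _ C]) auto
  have fin: "(\<integral>\<^sup>+\<omega>. ennreal \<bar>X \<omega> - g \<omega>\<bar> \<partial>Q) < \<infinity>"
    using close by (rule order.strict_trans1) simp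
  then have d: "integrable Q (\<lambda>\<omega>. X \<omega> - g \<omega>)"
    using X g by (simp add: integrable_iff_bounded)
  from Bochner_Integration.integrable_add[OF d ig] show iX: "integrable Q X" by simp
  have "\<bar>(\<integral>\<omega>. X \<omega> \<partial>Q) - (\<integral>\<omega>. g \<omega> \<partial>Q)\<bar> = \<bar>\<integral>\<omega>. X \<omega> - g \<omega> \<partial>Q\<bar>"
    using iX ig by simp
  also have "\<dots> \<le> (\<integral>\<omega>. \<bar>X \<omega> - g \<omega>\<bar> \<partial>Q)" by (rule integral_abs_bound)
  also have "ennreal \<dots> \<le> ennreal \<epsilon>"
    using close d by (subst nn_integral_eq_integral[symmetric]) auto
  then have "(\<integral>\<omega>. \<bar>X \<omega> - g \<omega>\<bar> \<partial>Q) \<le> \<epsilon>" using \<epsilon> by (simp add: ennreal_le_iff)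
  finally show "\<bar>(\<integral>\<omega>. X \<omega> \<partial>Q) - (\<integral>\<omega>. g \<omega> \<partial>Q)\<bar> \<le> \<epsilon>" .
qed

lemma bounded_approx_integrable:
  assumes "X \<in> bounded_approx M D" "D \<subseteq> ac_prob_measures M" "Q \<in> D"
  shows "integrable Q X"
proof -
  obtain g C where "g \<in> borel_measurable M" "\<And>\<omega>. \<bar>g \<omega>\<bar> \<le> C"
    "\<And>Q. Q \<in> D \<Longrightarrow> (\<integral>\<^sup>+\<omega>. ennreal \<bar>X \<omega> - g \<omega>\<bar> \<partial>Q) \<le> ennreal 1"
    using bounded_approxE[OF assms(1), of 1] by (metis zero_less_one)
  then show ?thesis
    using assms bounded_approx_measurable[OF assms(1)] by (intro integral_close(1)[of Q M X g C 1]) auto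
qed

lemma bounded_approx_integral_bounded:
  assumes X: "X \<in> bounded_approx M D" and D: "D \<subseteq> ac_prob_measures M"
  shows "\<exists>B. \<forall>Q\<in>D. \<bar>\<integral>\<omega>. X \<omega> \<partial>Q\<bar> \<le> B"
proof -
  obtain g C where g: "g \<in> borel_measurable M" "\<And>\<omega>. \<bar>g \<omega>\<bar> \<le> C"
    "\<And>Q. Q \<in> D \<Longrightarrow> (\<integral>\<^sup>+\<omega>. ennreal \<bar>X \<omega> - g \<omega>\<bar> \<partial>Q) \<le> ennreal 1"
    using bounded_approxE[OF X, of 1] by (metis zero_less_one)
  have "\<bar>\<integral>\<omega>. X \<omega> \<partial>Q\<bar> \<le> C + 1" if "Q \<in> D" for Q
  proof -
    have Q: "Q \<in> ac_prob_measures M" using that D by blast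
    interpret Q: prob_space Q by (rule ac_prob_measuresD(1)[OF Q])
    note c = integral_close[OF Q bounded_approx_measurable[OF X] g(1,2) g(3)[OF that]]
    have "\<bar>\<integral>\<omega>. g \<omega> \<partial>Q\<bar> \<le> (\<integral>\<omega>. \<bar>g \<omega>\<bar> \<partial>Q)" by (rule integral_abs_bound)
    also have "\<dots> \<le> C" using c(2) g(2) by (intro Q.integral_le_const) auto
    finally show ?thesis using c(3) by simp
  qed
  then show ?thesis by blast
qed

text \<open>The topology tests densities only against bounded functions, whereas
  \<open>\<psi> i\<close> may be unbounded. Around each \<open>Q\<close> a basic open set is built
  from a bounded approximation that is uniformly good on \<open>D\<close>.\<close>

lemma (in prob_space) weakly_compact_finite_cover:
  assumes cpt: "weakly_compact M D" and D: "D \<subseteq> ac_prob_measures M"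
    and \<psi>: "\<And>i. i \<in> I \<Longrightarrow> \<psi> i \<in> bounded_approx M D"
    and cover: "\<And>Q. Q \<in> D \<Longrightarrow> \<exists>i\<in>I. c < (\<integral>\<omega>. \<psi> i \<omega> \<partial>Q)"
  shows "\<exists>F\<subseteq>I. finite F \<and> (\<forall>Q\<in>D. \<exists>i\<in>F. c < (\<integral>\<omega>. \<psi> i \<omega> \<partial>Q))"
proof -
  let ?z = "\<lambda>Q \<omega>. enn2real (RN_deriv M Q \<omega>)"
  have "\<exists>i U. i \<in> I \<and> openin (weak_L1_topology M) U \<and> ?z Q \<in> U \<and> (\<forall>R\<in>D. ?z R \<in> U \<longrightarrow> c < (\<integral>\<omega>. \<psi> i \<omega> \<partial>R))"
    if "Q \<in> D" for Q
  proof -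
    obtain i where i: "i \<in> I" "c < (\<integral>\<omega>. \<psi> i \<omega> \<partial>Q)" using cover \<open>Q \<in> D\<close> by blast
    \<comment> \<open>A third of the slack: replacing \<open>\<psi> i\<close> by \<open>g\<close>
      costs one \<epsilon> at \<open>Q\<close>, so \<open>g\<close> integrates to at least
      \<open>c + 2 * \<epsilon>\<close>, inside the open condition
      \<open>c + \<epsilon> < ...\<close>; returning to \<open>\<psi> i\<close> at another measure
      costs one more \<epsilon> and still leaves more than \<open>c\<close>.\<close>
    define \<epsilon> where "\<epsilon> = ((\<integral>\<omega>. \<psi> i \<omega> \<partial>Q) - c) / 3"
    have "\<epsilon> > 0" using i by (simp add: \<epsilon>_def)
    from bounded_approxE[OF \<psi>[OF i(1)] this] obtain g C where g: "g \<in> borel_measurable M" "\<And>\<omega>. \<bar>g \<omega>\<bar> \<le> C"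
      "\<And>Q. Q \<in> D \<Longrightarrow> (\<integral>\<^sup>+\<omega>. ennreal \<bar>\<psi> i \<omega> - g \<omega>\<bar> \<partial>Q) \<le> ennreal \<epsilon>" by blast
    define U where "U = {Z. integrable M Z \<and> (\<integral>\<omega>. Z \<omega> * g \<omega> \<partial>M) \<in> {c + \<epsilon><..}}"
    have "AE \<omega> in M. \<bar>g \<omega>\<bar> \<le> C" using g(2) by simp
    then have "openin (weak_L1_topology M) U"
      unfolding weak_L1_topology_def U_def using g(1)
      by (intro topology_generated_by_Basis CollectI exI[of _ g] exI[of _ "{c + \<epsilon><..}"] conjI refl) auto
    have close: "integrable M (?z R)" "\<bar>(\<integral>\<omega>. \<psi> i \<omega> \<partial>R) - (\<integral>\<omega>. ?z R \<omega> * g \<omega> \<partial>M)\<bar> \<le> \<epsilon>" if R: "R \<in> D" for R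
    proof -
      have R': "R \<in> ac_prob_measures M" using R D by blast
      interpret R: prob_space R by (rule ac_prob_measuresD(1)[OF R'])
      note rn = R.sigma_finite_measure_axioms ac_prob_measuresD(3,2)[OF R']
      show "integrable M (?z R)"
        using RN_deriv_integrable[OF rn, of "\<lambda>_. 1"] by simp
      show "\<bar>(\<integral>\<omega>. \<psi> i \<omega> \<partial>R) - (\<integral>\<omega>. ?z R \<omega> * g \<omega> \<partial>M)\<bar> \<le> \<epsilon>"
        using integral_close(3)[OF R' bounded_approx_measurable[OF \<psi>[OF i(1)]] g(1,2) g(3)[OF R] \<open>\<epsilon> > 0\<close>]
          RN_deriv_integral[OF rn g(1)] by simp
    qed
    have "(\<integral>\<omega>. \<psi> i \<omega> \<partial>Q) = c + 3 * \<epsilon>" by (simp add: \<epsilon>_def field_simps)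
    then have "?z Q \<in> U" using close[OF \<open>Q \<in> D\<close>] \<open>\<epsilon> > 0\<close> by (auto simp: U_def abs_le_iff)
    moreover have "c < (\<integral>\<omega>. \<psi> i \<omega> \<partial>R)" if "R \<in> D" "?z R \<in> U" for R
      using close(2)[OF that(1)] that(2) by (auto simp: U_def)
    ultimately show ?thesis using i(1) \<open>openin _ U\<close> by blast
  qed
  then obtain i U where iU: "\<And>Q. Q \<in> D \<Longrightarrow> i Q \<in> I" "\<And>Q. Q \<in> D \<Longrightarrow> openin (weak_L1_topology M) (U Q)"
      "\<And>Q. Q \<in> D \<Longrightarrow> ?z Q \<in> U Q" "\<And>Q R. Q \<in> D \<Longrightarrow> R \<in> D \<Longrightarrow> ?z R \<in> U Q \<Longrightarrow> c < (\<integral>\<omega>. \<psi> (i Q) \<omega> \<partial>R)"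
    by metis
  have "\<exists>\<F>. finite \<F> \<and> \<F> \<subseteq> U ` D \<and> ?z ` D \<subseteq> \<Union>\<F>"
    using cpt unfolding weakly_compact_def by (rule compactinD) (use iU in auto)
  then obtain D' where D': "finite D'" "D' \<subseteq> D" "?z ` D \<subseteq> \<Union>(U ` D')"
    by (metis finite_subset_image)
  show ?thesis
  proof (intro exI[of _ "i ` D'"] conjI ballI)
    fix R assume R: "R \<in> D"
    then obtain Q where "Q \<in> D'" "?z R \<in> U Q" using D'(3) by blast
    then show "\<exists>i\<in>i ` D'. c < (\<integral>\<omega>. \<psi> i \<omega> \<partial>R)" using iU(4) R D'(2) by blast
  qed (use D' iU in auto)
qed

text \<open>The class on the right lies between the witness \<open>A'\<close> of consistency and
  \<open>A\<close>, which impose the same constraints on \<open>D\<close>. Membership thereby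
  becomes a condition on finite integrals.\<close>

lemma risk_neutral_approx:
  assumes D: "D \<subseteq> ac_prob_measures M" and con: "consistent M D A"
  shows "D \<inter> risk_neutral M A = {Q \<in> D. \<forall>X\<in>A \<inter> bounded_approx M D. (\<integral>\<omega>. X \<omega> \<partial>Q) \<le> 0}"
proof -
  obtain A' where A': "A' \<subseteq> A \<inter> L1s M D" "D \<inter> risk_neutral M A = D \<inter> risk_neutral M A'"
    using con by (auto simp: consistent_def)
  have E: "expct Q X \<le> 0 \<longleftrightarrow> (\<integral>\<omega>. X \<omega> \<partial>Q) \<le> 0" if "Q \<in> D" "X \<in> bounded_approx M D" for Q X
    using bounded_approx_integrable[OF that(2) D that(1)] by (simp add: expct_integrable)
  have "A' \<subseteq> A \<inter> bounded_approx M D" using A'(1) L1s_subset_bounded_approx by blast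
  then show ?thesis
    using E A'(2) D unfolding risk_neutral_def by blast
qed

text \<open>Each \<open>Q\<close> in \<open>D\<close> is beaten by some \<xi>: the zero claim if
  \<open>Q\<close> is risk neutral, otherwise a large multiple of a claim with positive mean.
  Compactness leaves finitely many \<xi>, and minimax merges them into one that works for all
  \<open>Q\<close> at once. The strict inequality assumed on \<open>c\<close> is what the open cover
  needs.\<close>

lemma (in prob_space) superhedging:
  assumes cpt: "weakly_compact M D" and D: "D \<subseteq> ac_prob_measures M" "D \<noteq> {}"
    and mix: "\<And>Q1 Q2 t. Q1 \<in> D \<Longrightarrow> Q2 \<in> D \<Longrightarrow> 0 < t \<Longrightarrow> t < 1 \<Longrightarrow> \<exists>R\<in>D. mixture M t Q1 Q2 R"
    and A: "convex_cone_rv A" and con: "consistent M D A"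
    and Y: "Y \<in> bounded_approx M D"
    and c: "\<And>Q. Q \<in> D \<inter> risk_neutral M A \<Longrightarrow> c < (\<integral>\<omega>. Y \<omega> \<partial>Q)"
  shows "\<exists>\<xi>\<in>A. \<forall>Q\<in>D. ereal c \<le> expct Q (\<lambda>\<omega>. Y \<omega> + \<xi> \<omega>)"
proof -
  let ?V = "A \<inter> bounded_approx M D"
  let ?\<Phi> = "\<lambda>\<xi> Q. \<integral>\<omega>. Y \<omega> + \<xi> \<omega> \<partial>Q"
  note int = bounded_approx_integrable[OF _ D(1)]
  have ba: "(\<lambda>\<omega>. Y \<omega> + \<xi> \<omega>) \<in> bounded_approx M D" if "\<xi> \<in> ?V" for \<xi>
    using that Y D(1) by (intro bounded_approx_add) auto
  have "\<exists>F\<subseteq>?V. finite F \<and> (\<forall>Q\<in>D. \<exists>\<xi>\<in>F. c < ?\<Phi> \<xi> Q)"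
  proof (rule weakly_compact_finite_cover[OF cpt D(1)])
    show "\<exists>\<xi>\<in>?V. c < ?\<Phi> \<xi> Q" if Q: "Q \<in> D" for Q
    proof (cases "\<exists>X\<in>?V. (\<integral>\<omega>. X \<omega> \<partial>Q) > 0")
      case True
      then obtain X where X: "X \<in> ?V" "(\<integral>\<omega>. X \<omega> \<partial>Q) > 0" by blast
      \<comment> \<open>With this multiple the mean of \<open>Y + t * X\<close> under
        \<open>Q\<close> is at least \<open>c + 1\<close>.\<close>
      define t where "t = (\<bar>c - (\<integral>\<omega>. Y \<omega> \<partial>Q)\<bar> + 1) / (\<integral>\<omega>. X \<omega> \<partial>Q)"
      have t: "t \<ge> 0" "t * (\<integral>\<omega>. X \<omega> \<partial>Q) = \<bar>c - (\<integral>\<omega>. Y \<omega> \<partial>Q)\<bar> + 1"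
        using X(2) by (auto simp: t_def)
      have tX: "(\<lambda>\<omega>. t * X \<omega>) \<in> ?V"
        using A X(1) t(1) D(1) by (auto simp: convex_cone_rv_def intro: bounded_approx_cmult)
      have "?\<Phi> (\<lambda>\<omega>. t * X \<omega>) Q = (\<integral>\<omega>. Y \<omega> \<partial>Q) + t * (\<integral>\<omega>. X \<omega> \<partial>Q)"
        using int[OF Y Q] int[OF _ Q] X(1) by simp
      then have "c < ?\<Phi> (\<lambda>\<omega>. t * X \<omega>) Q" using t(2) by linarith
      then show ?thesis using tX by (rule bexI)
    next
      case False
      then have "Q \<in> D \<inter> risk_neutral M A"
        using Q by (auto simp: risk_neutral_approx[OF D(1) con] not_less)
      moreover have "(\<lambda>_. 0) \<in> ?V"
      proof -
        have "(\<lambda>_. 0) \<in> A" using A by (simp add: convex_cone_rv_def)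
        moreover have "(\<lambda>_. 0) \<in> bounded_approx M D"
          using bounded_approx_cmult[OF Y D(1), of 0] by simp
        ultimately show ?thesis by blast
      qed
      ultimately show ?thesis using c by (intro bexI[of _ "\<lambda>_. 0"]) auto
    qed
  qed (rule ba)
  then obtain F where F: "F \<subseteq> ?V" "finite F" "\<And>Q. Q \<in> D \<Longrightarrow> \<exists>\<xi>\<in>F. c < ?\<Phi> \<xi> Q" by blast
  have "\<exists>\<xi>\<in>?V. \<forall>Q\<in>D. c \<le> ?\<Phi> \<xi> Q"
  \<comment> \<open>The claims are drawn from \<open>?V\<close> rather than \<open>A\<close>, so
    that every expectation is finite and affine in both the claim and the measure.\<close>
  proof (rule finite_minimax[OF F(2) _ F(1)])
    show "F \<noteq> {}" using F(3) D(2) by blast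
    show "\<exists>\<xi>\<in>F. c \<le> ?\<Phi> \<xi> Q" if "Q \<in> D" for Q
      using F(3)[OF that] by (auto intro: less_imp_le)
    show "\<exists>\<xi>\<in>?V. \<forall>Q\<in>D. ?\<Phi> \<xi> Q = (1 - t) * ?\<Phi> a Q + t * ?\<Phi> b Q"
      if ab: "a \<in> ?V" "b \<in> ?V" and t: "0 < t" "t < 1" for a b t
    proof (intro bexI ballI)
      show "(\<lambda>\<omega>. (1 - t) * a \<omega> + t * b \<omega>) \<in> ?V"
      proof
        show "(\<lambda>\<omega>. (1 - t) * a \<omega> + t * b \<omega>) \<in> A"
          using A ab t unfolding convex_cone_rv_def by auto
        show "(\<lambda>\<omega>. (1 - t) * a \<omega> + t * b \<omega>) \<in> bounded_approx M D"
          using ab D(1) by (intro bounded_approx_add bounded_approx_cmult) auto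
      qed
      fix Q assume Q: "Q \<in> D"
      have "integrable Q Y" "integrable Q a" "integrable Q b" using int[OF _ Q] Y ab by auto
      then show "?\<Phi> (\<lambda>\<omega>. (1 - t) * a \<omega> + t * b \<omega>) Q = (1 - t) * ?\<Phi> a Q + t * ?\<Phi> b Q"
        by (simp add: algebra_simps)
    qed
    show "\<exists>R\<in>D. \<forall>\<xi>\<in>?V. ?\<Phi> \<xi> R = (1 - t) * ?\<Phi> \<xi> Q1 + t * ?\<Phi> \<xi> Q2"
      if Q: "Q1 \<in> D" "Q2 \<in> D" and t: "0 < t" "t < 1" for Q1 Q2 t
    proof -
      obtain R where R: "R \<in> D" "mixture M t Q1 Q2 R" using mix[OF Q t] by blast
      have "?\<Phi> \<xi> R = (1 - t) * ?\<Phi> \<xi> Q1 + t * ?\<Phi> \<xi> Q2" if "\<xi> \<in> ?V" for \<xi>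
        using int[OF ba[OF that]] Q
        by (intro mixture_integral(2)[OF R(2) t bounded_approx_measurable[OF ba[OF that]]]) auto
      then show ?thesis using R(1) by blast
    qed
  qed
  then obtain \<xi> where "\<xi> \<in> ?V" "\<And>Q. Q \<in> D \<Longrightarrow> c \<le> ?\<Phi> \<xi> Q" by blast
  then show ?thesis
    using int[OF ba] by (intro bexI[of _ \<xi>]) (auto simp: expct_integrable)
qed

section \<open>Duality for a single agent\<close>

lemma INF_ereal_add_real:
  fixes f :: "'i \<Rightarrow> ereal"
  assumes "I \<noteq> {}"
  shows "(INF i\<in>I. f i + ereal c) = (INF i\<in>I. f i) + ereal c"
proof -
  have "(INF i\<in>I. ereal c - (- f i)) = ereal c - (SUP i\<in>I. - f i)"
    using assms by (intro INF_ereal_minus_right) auto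
  then show ?thesis by (simp add: ereal_SUP_uminus_eq minus_ereal_def add.commute)
qed

lemma bounded_approx_sum:
  assumes "finite I" "I \<noteq> {}" and D: "D \<subseteq> ac_prob_measures M"
    and "\<And>i. i \<in> I \<Longrightarrow> X i \<in> bounded_approx M D"
  shows "(\<lambda>\<omega>. \<Sum>i\<in>I. X i \<omega>) \<in> bounded_approx M D"
  using assms(1,2,4)
proof (induction I rule: finite_ne_induct)
  case (insert i I)
  then show ?case by (auto intro!: bounded_approx_add D)
qed simp

text \<open>One agent of the economy in isolation. A closure is empty only if the set is, so
  \<open>G_nonempty\<close> says that some measure in \<open>D\<close> is risk neutral for
  \<open>A\<close>.\<close>

locale agent = prob_space M
  for M :: "'a measure" +
  fixes u :: "('a \<Rightarrow> real) \<Rightarrow> ereal" and D :: "'a measure set" and A :: "('a \<Rightarrow> real) set"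
    and W :: "'a \<Rightarrow> real" and S :: "'a \<Rightarrow> real ^ 'd"
    and G :: "(real ^ 'd) set" and Gt :: "((real ^ 'd) \<times> real) set"
  assumes coherent: "coherent_utility M u" and D: "D = determining_set M u"
    and D_compact: "weakly_compact M D" and A_measurable: "A \<subseteq> borel_measurable M"
    and cone: "convex_cone_rv A" and con: "consistent M D A"
    and W: "W \<in> L1s M D" and S: "\<And>i. (\<lambda>\<omega>. S \<omega> $ i) \<in> L1s M D"
    and G: "G = closure {\<integral>\<omega>. S \<omega> \<partial>Q | Q. Q \<in> D \<inter> risk_neutral M A}"
    and Gt: "Gt = closure {\<integral>\<omega>. (S \<omega>, W \<omega>) \<partial>Q | Q. Q \<in> D \<inter> risk_neutral M A}"
    and G_nonempty: "G \<noteq> {}"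
begin

abbreviation RD :: "'a measure set" where "RD \<equiv> D \<inter> risk_neutral M A"

lemma D_ac: "D \<subseteq> ac_prob_measures M" and D_nonempty: "D \<noteq> {}"
  and u_eq: "X \<in> borel_measurable M \<Longrightarrow> u X = (INF Q\<in>D. expct Q X)"
  using determining_set_greatest(1)[OF coherent] by (auto simp: represents_def D)

lemma D_mixture: "Q1 \<in> D \<Longrightarrow> Q2 \<in> D \<Longrightarrow> 0 < t \<Longrightarrow> t < 1 \<Longrightarrow> \<exists>R\<in>D. mixture M t Q1 Q2 R"
  using determining_set_mixture[OF coherent] by (simp add: D)

lemma W_approx: "W \<in> bounded_approx M D" and S_approx: "(\<lambda>\<omega>. S \<omega> $ i) \<in> bounded_approx M D"
  using W S L1s_subset_bounded_approx by blast+

lemma endowment_approx: "(\<lambda>\<omega>. W \<omega> + \<eta> \<bullet> S \<omega>) \<in> bounded_approx M D"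
  unfolding inner_vec_def inner_real_def
  by (intro bounded_approx_add bounded_approx_sum bounded_approx_cmult W_approx S_approx D_ac) auto

lemma S_measurable: "S \<in> borel_measurable M"
proof -
  have "(\<lambda>\<omega>. S \<omega> \<bullet> b) \<in> borel_measurable M" if "b \<in> Basis" for b
    using that bounded_approx_measurable[OF S_approx] by (auto simp: Basis_vec_def inner_axis)
  then show ?thesis by (subst borel_measurable_euclidean_space) blast
qed

lemma integrable_endowment:
  assumes Q: "Q \<in> D"
  shows "integrable Q S" "integrable Q W" "integrable Q (\<lambda>\<omega>. (S \<omega>, W \<omega>))"
proof -
  note int = bounded_approx_integrable[OF _ D_ac Q]
  have "S = (\<lambda>\<omega>. \<Sum>i\<in>UNIV. (S \<omega> $ i) *\<^sub>R axis i 1)"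
    by (auto simp: vec_eq_iff axis_def if_distrib sum.delta cong: if_cong)
  moreover have "integrable Q (\<lambda>\<omega>. \<Sum>i\<in>UNIV. (S \<omega> $ i) *\<^sub>R axis i (1::real))"
    by (intro Bochner_Integration.integrable_sum integrable_scaleR_left int S_approx)
  ultimately show iS: "integrable Q S" by metis
  show iW: "integrable Q W" by (rule int[OF W_approx])
  have "bounded_linear (\<lambda>x::real ^ 'd. (x, 0::real))" "bounded_linear (\<lambda>y::real. (0::real ^ 'd, y))"
    by (auto intro!: bounded_linear_Pair bounded_linear_ident bounded_linear_zero)
  from Bochner_Integration.integrable_add[OF integrable_bounded_linear[OF this(1) iS] integrable_bounded_linear[OF this(2) iW]]
  show "integrable Q (\<lambda>\<omega>. (S \<omega>, W \<omega>))" by simp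
qed

lemma integral_endowment:
  assumes Q: "Q \<in> D"
  shows "(\<integral>\<omega>. (S \<omega>, W \<omega>) \<partial>Q) = (\<integral>\<omega>. S \<omega> \<partial>Q, \<integral>\<omega>. W \<omega> \<partial>Q)"
    and "(\<integral>\<omega>. W \<omega> + \<eta> \<bullet> S \<omega> \<partial>Q) = (\<eta>, 1) \<bullet> (\<integral>\<omega>. (S \<omega>, W \<omega>) \<partial>Q)"
proof -
  note int = integrable_endowment[OF Q]
  show eq: "(\<integral>\<omega>. (S \<omega>, W \<omega>) \<partial>Q) = (\<integral>\<omega>. S \<omega> \<partial>Q, \<integral>\<omega>. W \<omega> \<partial>Q)"
    using integral_fst[OF int(3)] integral_snd[OF int(3)] by (simp add: prod_eq_iff)
  show "(\<integral>\<omega>. W \<omega> + \<eta> \<bullet> S \<omega> \<partial>Q) = (\<eta>, 1) \<bullet> (\<integral>\<omega>. (S \<omega>, W \<omega>) \<partial>Q)"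
    using int unfolding eq by (simp add: inner_Pair)
qed

abbreviation H :: "((real ^ 'd) \<times> real) set" where
  "H \<equiv> (\<lambda>Q. \<integral>\<omega>. (S \<omega>, W \<omega>) \<partial>Q) ` RD"

lemma Gt_closure: "Gt = closure H"
  unfolding Gt by (simp only: Setcompr_eq_image)

lemma G_closure: "G = closure (fst ` H)"
proof -
  have "fst ` H = (\<lambda>Q. \<integral>\<omega>. S \<omega> \<partial>Q) ` RD"
    unfolding image_image by (intro image_cong refl) (simp add: integral_endowment(1))
  then show ?thesis unfolding G by (simp only: Setcompr_eq_image)
qed

lemma H_bounded: "bounded H"
proof -
  obtain b where b: "\<And>i Q. Q \<in> D \<Longrightarrow> \<bar>\<integral>\<omega>. S \<omega> $ i \<partial>Q\<bar> \<le> b i"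
    using bounded_approx_integral_bounded[OF S_approx D_ac] by metis
  obtain w where w: "\<And>Q. Q \<in> D \<Longrightarrow> \<bar>\<integral>\<omega>. W \<omega> \<partial>Q\<bar> \<le> w"
    using bounded_approx_integral_bounded[OF W_approx D_ac] by metis
  have "norm z \<le> (\<Sum>i\<in>UNIV. b i) + w" if z: "z \<in> H" for z
  proof -
    obtain Q where Q: "Q \<in> D" and "z = (\<integral>\<omega>. (S \<omega>, W \<omega>) \<partial>Q)" using z by blast
    then have z: "z = (\<integral>\<omega>. S \<omega> \<partial>Q, \<integral>\<omega>. W \<omega> \<partial>Q)" using integral_endowment(1) by simp
    have "(\<integral>\<omega>. S \<omega> \<partial>Q) $ i = (\<integral>\<omega>. S \<omega> $ i \<partial>Q)" for i
      using integral_bounded_linear[OF bounded_linear_vec_nth integrable_endowment(1)[OF Q]] by simp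
    then have "norm (\<integral>\<omega>. S \<omega> \<partial>Q) \<le> (\<Sum>i\<in>UNIV. b i)"
      using norm_le_l1_cart[of "\<integral>\<omega>. S \<omega> \<partial>Q"] b[OF Q] by (metis (no_types, lifting) order_trans sum_mono)
    moreover have "norm z \<le> norm (\<integral>\<omega>. S \<omega> \<partial>Q) + norm (\<integral>\<omega>. W \<omega> \<partial>Q)"
      unfolding z norm_Pair by (intro sqrt_sum_squares_le_sum) auto
    ultimately show ?thesis using w[OF Q] by simp
  qed
  then show ?thesis by (rule boundedI)
qed

text \<open>Risk neutrality is tested on integrable claims only, and for these the mean under a
  mixture is the mixture of the means.\<close>

lemma RD_mixture:
  assumes "Q1 \<in> RD" "Q2 \<in> RD" and t: "0 < t" "t < 1"
  shows "\<exists>R\<in>RD. mixture M t Q1 Q2 R"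
proof -
  note RD = risk_neutral_approx[OF D_ac con]
  have Q: "Q1 \<in> D" "Q2 \<in> D" using assms by auto
  obtain R where R: "R \<in> D" "mixture M t Q1 Q2 R" using D_mixture[OF Q t] by blast
  have "(\<integral>\<omega>. X \<omega> \<partial>R) \<le> 0" if X: "X \<in> A \<inter> bounded_approx M D" for X
  proof -
    have "integrable Q1 X" "integrable Q2 X" "X \<in> borel_measurable M"
      using X bounded_approx_integrable[OF _ D_ac] bounded_approx_measurable Q by auto
    then have "(\<integral>\<omega>. X \<omega> \<partial>R) = (1 - t) * (\<integral>\<omega>. X \<omega> \<partial>Q1) + t * (\<integral>\<omega>. X \<omega> \<partial>Q2)"
      by (intro mixture_integral(2)[OF R(2) t])
    also have "\<dots> \<le> 0"
      using assms(1,2) X t unfolding RD by (intro add_nonpos_nonpos mult_nonneg_nonpos) auto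
    finally show ?thesis .
  qed
  then have "R \<in> RD" unfolding RD using R(1) by blast
  then show ?thesis using R(2) by blast
qed

lemma H_convex: "convex H"
  unfolding convex_alt
proof (intro ballI allI impI)
  fix x y and t :: real
  assume xy: "x \<in> H" "y \<in> H" and t: "0 \<le> t \<and> t \<le> 1"
  then obtain Q1 Q2 where Q: "Q1 \<in> RD" "Q2 \<in> RD"
    and x: "x = (\<integral>\<omega>. (S \<omega>, W \<omega>) \<partial>Q1)" and y: "y = (\<integral>\<omega>. (S \<omega>, W \<omega>) \<partial>Q2)" by blast
  consider "t = 0" | "t = 1" | "0 < t" "t < 1" using t by linarith
  then show "(1 - t) *\<^sub>R x + t *\<^sub>R y \<in> H"
  proof cases
    case 3
    obtain R where R: "R \<in> RD" "mixture M t Q1 Q2 R" using RD_mixture[OF Q 3] by blast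
    have m: "(\<lambda>\<omega>. (S \<omega>, W \<omega>)) \<in> borel_measurable M"
      using S_measurable bounded_approx_measurable[OF W_approx] by (rule borel_measurable_Pair)
    have iD: "integrable Q (\<lambda>\<omega>. (S \<omega>, W \<omega>))" if "Q \<in> RD" for Q
      using that by (intro integrable_endowment) auto
    have "(\<integral>\<omega>. (S \<omega>, W \<omega>) \<partial>R) = (1 - t) *\<^sub>R x + t *\<^sub>R y"
    \<comment> \<open>Mixture integrals are known for real functions, so the vector identity is
      checked coordinate by coordinate.\<close>
    proof (rule euclidean_eqI)
      fix b :: "(real ^ 'd) \<times> real"
      have "(\<integral>\<omega>. (S \<omega>, W \<omega>) \<bullet> b \<partial>R) = (1 - t) * (\<integral>\<omega>. (S \<omega>, W \<omega>) \<bullet> b \<partial>Q1) + t * (\<integral>\<omega>. (S \<omega>, W \<omega>) \<bullet> b \<partial>Q2)"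
        using Q by (intro mixture_integral(2)[OF R(2) 3] borel_measurable_inner m integrable_inner_left iD) auto
      then show "(\<integral>\<omega>. (S \<omega>, W \<omega>) \<partial>R) \<bullet> b = ((1 - t) *\<^sub>R x + t *\<^sub>R y) \<bullet> b"
        using iD[OF R(1)] iD[OF Q(1)] iD[OF Q(2)] by (simp add: x y inner_add_left)
    qed
    then show ?thesis using R(1) by (intro image_eqI[of _ _ R]) auto
  qed (use xy in auto)
qed

sublocale convex_body Gt
proof
  show "compact Gt" using H_bounded by (simp add: Gt_closure)
  show "convex Gt" unfolding Gt_closure by (intro convex_closure H_convex)
  show "Gt \<noteq> {}" using G_nonempty by (simp add: Gt_closure G_closure)
qed

lemma G_eq: "G = fst ` Gt"
  unfolding Gt_closure G_closure using fst_closure_bounded[OF H_bounded] by simp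

lemma admissible_measurable: "\<xi> \<in> A \<Longrightarrow> (\<lambda>\<omega>. W \<omega> + \<xi> \<omega> + \<eta> \<bullet> S \<omega>) \<in> borel_measurable M"
  using A_measurable S_measurable bounded_approx_measurable[OF W_approx]
  by (intro borel_measurable_add borel_measurable_inner) auto

section \<open>Weak and strong duality for the agent\<close>

text \<open>Weak duality: under a risk-neutral measure the claim \<xi> adds at most 0 to the mean of
  the endowment. The resulting bound on \<open>H\<close> passes to its closure because half-spaces
  are closed.\<close>

lemma u_le_support:
  assumes \<xi>: "\<xi> \<in> A"
  shows "u (\<lambda>\<omega>. W \<omega> + \<xi> \<omega> + \<eta> \<bullet> S \<omega>) \<le> ereal (support \<eta>)" (is "?u \<le> _")
proof -
  have le: "?u \<le> ereal ((\<eta>, 1) \<bullet> z)" if z: "z \<in> H" for z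
  proof -
    obtain Q where Q: "Q \<in> D" "Q \<in> risk_neutral M A" "z = (\<integral>\<omega>. (S \<omega>, W \<omega>) \<partial>Q)" using z by blast
    have "?u \<le> expct Q (\<lambda>\<omega>. W \<omega> + \<xi> \<omega> + \<eta> \<bullet> S \<omega>)"
      unfolding u_eq[OF admissible_measurable[OF \<xi>]] using Q(1) by (rule INF_lower)
    also have "\<dots> = expct Q (\<lambda>\<omega>. (W \<omega> + \<eta> \<bullet> S \<omega>) + \<xi> \<omega>)" by (simp add: add_ac)
    also have "\<dots> = ereal ((\<eta>, 1) \<bullet> z) + expct Q \<xi>"
    proof -
      have "\<xi> \<in> borel_measurable Q"
        using \<xi> A_measurable ac_prob_measuresD(4)[of Q M] Q(1) D_ac by blast
      then show ?thesis
        using bounded_approx_integrable[OF endowment_approx D_ac Q(1)]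
        by (subst expct_add) (auto simp: integral_endowment(2)[OF Q(1)] Q(3))
    qed
    also have "\<dots> \<le> ereal ((\<eta>, 1) \<bullet> z) + 0"
      using Q(2) \<xi> by (intro add_left_mono) (auto simp: risk_neutral_def)
    finally show ?thesis by simp
  qed
  show ?thesis
  proof (cases ?u)
    case (real r)
    have "closed {z. r \<le> (\<eta>, 1) \<bullet> z}" by (rule closed_halfspace_ge)
    moreover have "H \<subseteq> {z. r \<le> (\<eta>, 1) \<bullet> z}" using le real by auto
    ultimately have "Gt \<subseteq> {z. r \<le> (\<eta>, 1) \<bullet> z}" unfolding Gt_closure by (rule closure_minimal[rotated])
    then have "r \<le> support \<eta>" by (intro support_ge) (force simp: inner_Pair)
    then show ?thesis by (simp add: real)
  next
    case PInf
    have "H \<noteq> {}" using nonempty by (auto simp: Gt_closure)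
    then show ?thesis using le PInf by fastforce
  qed simp
qed

text \<open>Strong duality: each real level strictly below \<open>support \<eta>\<close> lies
  strictly below all risk-neutral means of the endowment, hence is reached by some claim through
  superhedging. Attainment of the supremum is not asserted.\<close>

lemma SUP_u: "(SUP \<xi>\<in>A. u (\<lambda>\<omega>. W \<omega> + \<xi> \<omega> + \<eta> \<bullet> S \<omega>)) = ereal (support \<eta>)"
proof (rule antisym)
  show "(SUP \<xi>\<in>A. u (\<lambda>\<omega>. W \<omega> + \<xi> \<omega> + \<eta> \<bullet> S \<omega>)) \<le> ereal (support \<eta>)"
    by (intro SUP_least u_le_support)
  show "ereal (support \<eta>) \<le> (SUP \<xi>\<in>A. u (\<lambda>\<omega>. W \<omega> + \<xi> \<omega> + \<eta> \<bullet> S \<omega>))"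
  proof (rule dense_le)
    fix c :: ereal assume c: "c < ereal (support \<eta>)"
    show "c \<le> (SUP \<xi>\<in>A. u (\<lambda>\<omega>. W \<omega> + \<xi> \<omega> + \<eta> \<bullet> S \<omega>))"
    proof (cases c)
      case (real r)
      have "\<exists>\<xi>\<in>A. \<forall>Q\<in>D. ereal r \<le> expct Q (\<lambda>\<omega>. W \<omega> + \<eta> \<bullet> S \<omega> + \<xi> \<omega>)"
      proof (rule superhedging[OF D_compact D_ac D_nonempty D_mixture cone con endowment_approx])
        fix Q assume Q: "Q \<in> RD"
        then have "(\<integral>\<omega>. (S \<omega>, W \<omega>) \<partial>Q) \<in> Gt"
          unfolding Gt_closure by (intro subsetD[OF closure_subset]) auto
        then have "support \<eta> \<le> (\<eta>, 1) \<bullet> (\<integral>\<omega>. (S \<omega>, W \<omega>) \<partial>Q)"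
          using support_le[of "fst (\<integral>\<omega>. (S \<omega>, W \<omega>) \<partial>Q)" "snd (\<integral>\<omega>. (S \<omega>, W \<omega>) \<partial>Q)" \<eta>]
          by (simp add: inner_prod_def)
        then show "r < (\<integral>\<omega>. W \<omega> + \<eta> \<bullet> S \<omega> \<partial>Q)"
          using c Q by (simp add: real integral_endowment(2))
      qed
      then obtain \<xi> where \<xi>: "\<xi> \<in> A" "\<And>Q. Q \<in> D \<Longrightarrow> ereal r \<le> expct Q (\<lambda>\<omega>. W \<omega> + \<xi> \<omega> + \<eta> \<bullet> S \<omega>)"
        by (auto simp: add_ac)
      have "ereal r \<le> u (\<lambda>\<omega>. W \<omega> + \<xi> \<omega> + \<eta> \<bullet> S \<omega>)"
        unfolding u_eq[OF admissible_measurable[OF \<xi>(1)]] using \<xi>(2) by (rule INF_greatest)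
      then show ?thesis using \<xi>(1) real by (auto intro: SUP_upper2)
    qed (use c in auto)
  qed
qed

lemma u_translate:
  assumes X: "X \<in> borel_measurable M"
  shows "u (\<lambda>\<omega>. X \<omega> + c) = u X + ereal c"
proof -
  have "expct Q (\<lambda>\<omega>. X \<omega> + c) = expct Q X + ereal c" if "Q \<in> D" for Q
  proof -
    have Q: "Q \<in> ac_prob_measures M" using that D_ac by blast
    interpret Q: prob_space Q by (rule ac_prob_measuresD(1)[OF Q])
    have "expct Q (\<lambda>\<omega>. c + X \<omega>) = ereal (\<integral>\<omega>. c \<partial>Q) + expct Q X"
      using X ac_prob_measuresD(4)[OF Q] by (intro expct_add) auto
    then show ?thesis by (simp add: add.commute Q.prob_space)
  qed
  then have "u (\<lambda>\<omega>. X \<omega> + c) = (INF Q\<in>D. expct Q X + ereal c)"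
    using X by (subst u_eq) (auto intro!: INF_cong)
  then show ?thesis using X by (simp add: INF_ereal_add_real[OF D_nonempty] u_eq)
qed

lemma u_price:
  "\<xi> \<in> A \<Longrightarrow> u (\<lambda>\<omega>. W \<omega> + \<xi> \<omega> + \<eta> \<bullet> (S \<omega> - P)) = u (\<lambda>\<omega>. W \<omega> + \<xi> \<omega> + \<eta> \<bullet> S \<omega>) + ereal (- (\<eta> \<bullet> P))"
  using u_translate[OF admissible_measurable, of \<xi> \<eta> "- (\<eta> \<bullet> P)"]
  by (simp add: inner_diff_right algebra_simps)

text \<open>The joint optimisation is done in two stages. For fixed \<eta> the claims contribute
  \<open>support \<eta> - \<eta> \<bullet> P\<close>; maximising this over \<eta> evaluates the
  biconjugate of the lower boundary at \<open>P\<close>. A joint optimum must be optimal in both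
  stages.\<close>

lemma optimal_iff:
  assumes X: "X \<in> A"
  shows "u (\<lambda>\<omega>. W \<omega> + X \<omega> + h \<bullet> (S \<omega> - P))
        = (SUP (\<xi>, \<eta>)\<in>A \<times> UNIV. u (\<lambda>\<omega>. W \<omega> + \<xi> \<omega> + \<eta> \<bullet> (S \<omega> - P))) \<longleftrightarrow>
    P \<in> G \<and> h \<in> normal_directions Gt P \<and> is_arg_max (\<lambda>\<xi>. u (\<lambda>\<omega>. W \<omega> + \<xi> \<omega> + h \<bullet> S \<omega>)) (\<lambda>\<xi>. \<xi> \<in> A) X"
    (is "?U X h = ?T \<longleftrightarrow> _")
proof -
  let ?u = "\<lambda>\<xi> \<eta>. u (\<lambda>\<omega>. W \<omega> + \<xi> \<omega> + \<eta> \<bullet> S \<omega>)"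
  have argmax: "is_arg_max (\<lambda>\<xi>. ?u \<xi> h) (\<lambda>\<xi>. \<xi> \<in> A) X \<longleftrightarrow> ?u X h = ereal (support h)"
  proof
    assume "is_arg_max (\<lambda>\<xi>. ?u \<xi> h) (\<lambda>\<xi>. \<xi> \<in> A) X"
    then have "(SUP \<xi>\<in>A. ?u \<xi> h) \<le> ?u X h" by (auto simp: is_arg_max_def not_less intro: SUP_least)
    then show "?u X h = ereal (support h)" using u_le_support[OF X] by (simp add: SUP_u antisym)
  next
    assume "?u X h = ereal (support h)"
    then show "is_arg_max (\<lambda>\<xi>. ?u \<xi> h) (\<lambda>\<xi>. \<xi> \<in> A) X"
      using X u_le_support by (auto simp: is_arg_max_def not_less)
  qed
  have UT: "?U \<xi> \<eta> \<le> ?T" if "\<xi> \<in> A" for \<xi> \<eta>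
    using that by (intro SUP_upper2[of "(\<xi>, \<eta>)"]) auto
  have U: "?U \<xi> \<eta> \<le> ereal (support \<eta> - \<eta> \<bullet> P)" if "\<xi> \<in> A" for \<xi> \<eta>
    using add_right_mono[OF u_le_support[OF that, of \<eta>], of "ereal (- (\<eta> \<bullet> P))"]
    by (simp add: u_price[OF that])
  have T: "ereal (support \<eta> - \<eta> \<bullet> P) \<le> ?T" for \<eta>
  proof -
    have "ereal (support \<eta> - \<eta> \<bullet> P) = (SUP \<xi>\<in>A. ?u \<xi> \<eta>) + ereal (- (\<eta> \<bullet> P))"
      by (simp add: SUP_u)
    also have "\<dots> = (SUP \<xi>\<in>A. ?u \<xi> \<eta> + ereal (- (\<eta> \<bullet> P)))"
      using X by (intro SUP_ereal_add_left[symmetric]) auto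
    also have "\<dots> \<le> ?T"
      using UT by (intro SUP_least) (simp add: u_price[symmetric])
    finally show ?thesis .
  qed
  show ?thesis
  proof
    assume eq: "?U X h = ?T"
    \<comment> \<open>The value at \<open>(X, h)\<close> is the overall supremum and is bounded by a
      real number, which thus bounds every \<open>support \<eta> - \<eta> \<bullet> P\<close>: the
      premise of \<open>biconjugate_bound\<close>.\<close>
    have le: "support \<eta> - \<eta> \<bullet> P \<le> support h - h \<bullet> P" for \<eta>
      using order_trans[OF T[of \<eta>], of "ereal (support h - h \<bullet> P)"] U[OF X, of h] by (simp add: eq)
    note bc = biconjugate_bound[of P, OF le]
    \<comment> \<open>\<open>U\<close> and \<open>T\<close> squeeze the value; as the price term is
      finite it can then be cancelled.\<close>
    have "?u X h + ereal (- (h \<bullet> P)) = ereal (support h - h \<bullet> P)"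
      using U[OF X, of h] T[of h] eq by (simp add: u_price[OF X])
    then have "?u X h = ereal (support h)" by (cases "?u X h") auto
    moreover have "h \<in> normal_directions Gt P"
      using bc support_le_lower_boundary[OF bc(1), of h] by (simp add: normal_directions_iff)
    ultimately show "P \<in> G \<and> h \<in> normal_directions Gt P \<and> is_arg_max (\<lambda>\<xi>. ?u \<xi> h) (\<lambda>\<xi>. \<xi> \<in> A) X"
      using bc(1) by (simp add: argmax G_eq)
  next
    assume "P \<in> G \<and> h \<in> normal_directions Gt P \<and> is_arg_max (\<lambda>\<xi>. ?u \<xi> h) (\<lambda>\<xi>. \<xi> \<in> A) X"
    then have P: "P \<in> fst ` Gt" and h: "support h = h \<bullet> P + lower_boundary Gt P" and "?u X h = ereal (support h)"
      by (simp_all add: G_eq normal_directions_iff argmax)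
    then have UX: "?U X h = ereal (lower_boundary Gt P)" by (simp add: u_price[OF X])
    have "?T \<le> ereal (lower_boundary Gt P)"
    proof (rule SUP_least, clarify)
      fix \<xi> \<eta> assume "\<xi> \<in> A"
      then have "?U \<xi> \<eta> \<le> ereal (support \<eta> - \<eta> \<bullet> P)" by (rule U)
      also have "\<dots> \<le> ereal (lower_boundary Gt P)" using support_le_lower_boundary[OF P] by simp
      finally show "?U \<xi> \<eta> \<le> ereal (lower_boundary Gt P)" .
    qed
    then show "?U X h = ?T" using UT[OF X, of h] UX by simp
  qed
qed

end

section \<open>Equilibrium\<close>

theorem theorem4p14:
  fixes M :: "'a measure"
    and N :: nat
    and u :: "nat \<Rightarrow> ('a \<Rightarrow> real) \<Rightarrow> ereal"
    and D :: "nat \<Rightarrow> 'a measure set"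
    and A :: "nat \<Rightarrow> ('a \<Rightarrow> real) set"
    and W :: "nat \<Rightarrow> 'a \<Rightarrow> real"
    and S :: "'a \<Rightarrow> real ^ 'd"
    and G :: "nat \<Rightarrow> (real ^ 'd) set"
    and Gt :: "nat \<Rightarrow> ((real ^ 'd) \<times> real) set"
    and f :: "real ^ 'd \<Rightarrow> real"
  assumes "prob_space M"
    and "\<And>n. n \<in> {1..N} \<Longrightarrow> coherent_utility M (u n)"
    and "\<And>n. n \<in> {1..N} \<Longrightarrow> D n = determining_set M (u n)"
    and "\<And>n. n \<in> {1..N} \<Longrightarrow> weakly_compact M (D n)"
    and "\<And>n. n \<in> {1..N} \<Longrightarrow> A n \<subseteq> borel_measurable M"
    and "\<And>n. n \<in> {1..N} \<Longrightarrow> convex_cone_rv (A n)"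
    and "\<And>n. n \<in> {1..N} \<Longrightarrow> consistent M (D n) (A n)"
    and "\<And>n. n \<in> {1..N} \<Longrightarrow> W n \<in> L1s M (D n)"
    and "S \<in> borel_measurable M"
    and "\<And>n i. n \<in> {1..N} \<Longrightarrow> (\<lambda>\<omega>. S \<omega> $ i) \<in> L1s M (D n)"
    and "\<And>n. n \<in> {1..N} \<Longrightarrow>
          G n = closure {\<integral>\<omega>. S \<omega> \<partial>Q | Q. Q \<in> D n \<inter> risk_neutral M (A n)}"
    and "\<And>n. n \<in> {1..N} \<Longrightarrow>
          Gt n = closure {\<integral>\<omega>. (S \<omega>, W n \<omega>) \<partial>Q | Q. Q \<in> D n \<inter> risk_neutral M (A n)}"
    and "\<And>x. x \<in> (\<Inter>n\<in>{1..N}. G n) \<Longrightarrow> f x = (\<Sum>n=1..N. lower_boundary (Gt n) x)"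
    and "(\<Inter>n\<in>{1..N}. rel_interior (G n)) \<noteq> {}"
  shows
    "(\<forall>P. is_arg_min f (\<lambda>x. x \<in> (\<Inter>n\<in>{1..N}. G n)) P \<longrightarrow>
        (\<exists>h. (\<forall>n\<in>{1..N}. h n \<in> normal_directions (Gt n) P) \<and> (\<Sum>n=1..N. h n) = 0) \<and>
        (\<forall>h X. (\<forall>n\<in>{1..N}. h n \<in> normal_directions (Gt n) P) \<and> (\<Sum>n=1..N. h n) = 0 \<and>
           (\<forall>n\<in>{1..N}. is_arg_max (\<lambda>\<xi>. u n (\<lambda>\<omega>. W n \<omega> + \<xi> \<omega> + h n \<bullet> S \<omega>)) (\<lambda>\<xi>. \<xi> \<in> A n) (X n))
           \<longrightarrow> arrow_debreu_equilibrium N u A W S X h P)) \<and>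
     (\<forall>X h P. arrow_debreu_equilibrium N u A W S X h P \<longrightarrow>
        is_arg_min f (\<lambda>x. x \<in> (\<Inter>n\<in>{1..N}. G n)) P \<and>
        (\<forall>n\<in>{1..N}. h n \<in> normal_directions (Gt n) P) \<and> (\<Sum>n=1..N. h n) = 0 \<and>
        (\<forall>n\<in>{1..N}. is_arg_max (\<lambda>\<xi>. u n (\<lambda>\<omega>. W n \<omega> + \<xi> \<omega> + h n \<bullet> S \<omega>)) (\<lambda>\<xi>. \<xi> \<in> A n) (X n)))"
proof -
  have agent: "agent M (u n) (D n) (A n) (W n) S (G n) (Gt n)" if n: "n \<in> {1..N}" for n
  proof -
    have "G n \<noteq> {}" using assms(14) n rel_interior_subset by fastforce
    then show ?thesis
      unfolding agent_def agent_axioms_def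
      using assms(1) assms(2-8)[OF n] assms(10-12)[OF n] by blast
  qed
  let ?G = "\<Inter>n\<in>{1..N}. G n" and ?lb = "\<lambda>n. lower_boundary (Gt n)"
  have cvx: "convex_on (G n) (?lb n)" if "n \<in> {1..N}" for n
  proof -
    interpret agent M "u n" "D n" "A n" "W n" S "G n" "Gt n" by (rule agent[OF that])
    show ?thesis using convex_on_lower_boundary by (simp add: G_eq)
  qed
  have normal: "\<eta> \<in> normal_directions (Gt n) P \<longleftrightarrow> (\<forall>x\<in>G n. ?lb n P + \<eta> \<bullet> P \<le> ?lb n x + \<eta> \<bullet> x)"
    if "n \<in> {1..N}" "P \<in> G n" for n \<eta> P
  proof -
    interpret agent M "u n" "D n" "A n" "W n" S "G n" "Gt n" by (rule agent[OF that(1)])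
    show ?thesis using normal_directions_subgradient that(2) by (simp add: G_eq)
  qed
  note optimal = agent.optimal_iff[OF agent]
  \<comment> \<open>\<open>f\<close> is specified on the intersection of the \<open>G n\<close>
    only, and there it may be replaced by the sum of the lower boundaries.\<close>
  have argmin: "is_arg_min f (\<lambda>x. x \<in> ?G) P \<longleftrightarrow> P \<in> ?G \<and> (\<forall>x\<in>?G. (\<Sum>n=1..N. ?lb n P) \<le> (\<Sum>n=1..N. ?lb n x))" for P
  proof -
    have "is_arg_min f (\<lambda>x. x \<in> ?G) P \<longleftrightarrow> P \<in> ?G \<and> (\<forall>x\<in>?G. f P \<le> f x)"
      unfolding is_arg_min_def by (meson not_less)
    also have "\<dots> \<longleftrightarrow> P \<in> ?G \<and> (\<forall>x\<in>?G. (\<Sum>n=1..N. ?lb n P) \<le> (\<Sum>n=1..N. ?lb n x))"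
      by (intro conj_cong refl ball_cong) (simp only: assms(13))
    finally show ?thesis .
  qed
  have "\<exists>h. (\<forall>n\<in>{1..N}. h n \<in> normal_directions (Gt n) P) \<and> (\<Sum>n=1..N. h n) = 0"
    if "is_arg_min f (\<lambda>x. x \<in> ?G) P" for P
  proof -
    have P: "P \<in> ?G" "\<And>x. x \<in> ?G \<Longrightarrow> (\<Sum>n=1..N. ?lb n P) \<le> (\<Sum>n=1..N. ?lb n x)"
      using argmin[THEN iffD1, OF that] by blast+
    \<comment> \<open>The sum rule with tilt 0: the multipliers are the holdings, and their
      prescribed sum is market clearing.\<close>
    have "\<exists>h. (\<Sum>n=1..N. h n) = 0 \<and> (\<forall>n\<in>{1..N}. \<forall>x\<in>G n. ?lb n P + h n \<bullet> P \<le> ?lb n x + h n \<bullet> x)"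
      using P assms(14) cvx by (intro minimize_sum) auto
    then show ?thesis using normal P(1) by blast
  qed
  moreover have "arrow_debreu_equilibrium N u A W S X h P"
    if P: "is_arg_min f (\<lambda>x. x \<in> ?G) P" and h: "\<forall>n\<in>{1..N}. h n \<in> normal_directions (Gt n) P" "(\<Sum>n=1..N. h n) = 0"
      and X: "\<forall>n\<in>{1..N}. is_arg_max (\<lambda>\<xi>. u n (\<lambda>\<omega>. W n \<omega> + \<xi> \<omega> + h n \<bullet> S \<omega>)) (\<lambda>\<xi>. \<xi> \<in> A n) (X n)" for P h X
  proof -
    have "X n \<in> A n" if "n \<in> {1..N}" for n using X that by (auto simp: is_arg_max_def)
    moreover have "P \<in> G n" if "n \<in> {1..N}" for n using P that by (simp add: is_arg_min_def)
    ultimately show ?thesis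
      unfolding arrow_debreu_equilibrium_def using h X by (auto simp: optimal)
  qed
  moreover have "is_arg_min f (\<lambda>x. x \<in> ?G) P \<and>
        (\<forall>n\<in>{1..N}. h n \<in> normal_directions (Gt n) P) \<and> (\<Sum>n=1..N. h n) = 0 \<and>
        (\<forall>n\<in>{1..N}. is_arg_max (\<lambda>\<xi>. u n (\<lambda>\<omega>. W n \<omega> + \<xi> \<omega> + h n \<bullet> S \<omega>)) (\<lambda>\<xi>. \<xi> \<in> A n) (X n))"
    if eq: "arrow_debreu_equilibrium N u A W S X h P" for X h P
  proof -
    have n: "P \<in> G n \<and> h n \<in> normal_directions (Gt n) P \<and>
        is_arg_max (\<lambda>\<xi>. u n (\<lambda>\<omega>. W n \<omega> + \<xi> \<omega> + h n \<bullet> S \<omega>)) (\<lambda>\<xi>. \<xi> \<in> A n) (X n)" if n: "n \<in> {1..N}" for n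
      using eq n optimal[OF n, of "X n" "h n" P] unfolding arrow_debreu_equilibrium_def by blast
    have h0: "(\<Sum>n=1..N. h n) = 0" using eq by (simp add: arrow_debreu_equilibrium_def)
    have "(\<Sum>n=1..N. ?lb n P) \<le> (\<Sum>n=1..N. ?lb n x)" if x: "x \<in> ?G" for x
    proof -
      \<comment> \<open>Adding the agents' subgradient inequalities; the linear terms vanish on both
        sides because the holdings sum to 0.\<close>
      have "(\<Sum>n=1..N. ?lb n P + h n \<bullet> P) \<le> (\<Sum>n=1..N. ?lb n x + h n \<bullet> x)"
        using n normal x by (intro sum_mono) blast
      then show ?thesis using h0 by (simp add: sum.distrib inner_sum_left[symmetric])
    qed
    then show ?thesis unfolding argmin using n h0 by blast
  qed
  ultimately show ?thesis by blast
qed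

end
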